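(* Let $s,t$ be real numbers and let $\Gamma$ be a connected nonregular graph whose adjacency matrix has precisely the three distinct eigenvalues $s>1>-t$. If $\Gamma$ is a cone, then $\Gamma$ is the Petersen cone.
   Context: A graph on $n$ vertices is a cone if it has a vertex of degree $n-1$. The Petersen cone is the graph obtained from the Petersen graph by adding one new vertex adjacent to all ten of its vertices. *)

theory Defs
  imports
    "Graph_Theory.Graph_Theory"
    "Jordan_Normal_Form.Spectral_Radius"
begin

text \<open>
  A finite simple graph is a \<^const>\<open>pair_graph\<close>: a finite vertex set with a symmetric loop-free
  set of arcs, an undirected edge \<open>uv\<close> being the pair of arcs \<open>(u,v)\<close>, \<open>(v,u)\<close>. The degree of a
  vertex is therefore its \<^const>\<open>out_degree\<close>.
\<close>

text \<open>
  Matrices are indexed by natural numbers, so the adjacency matrix depends on an enumeration \<open>vs\<close>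
  of the vertices; a different enumeration conjugates it by a permutation matrix.
\<close>

definition adjacency_matrix :: "'a pair_pre_digraph \<Rightarrow> 'a list \<Rightarrow> real mat" where
  "adjacency_matrix G vs =
     mat (length vs) (length vs) (\<lambda>(i, j). if (vs ! i, vs ! j) \<in> parcs G then 1 else 0)"

definition regular_graph :: "'a pair_pre_digraph \<Rightarrow> bool" where
  "regular_graph G \<longleftrightarrow> (\<exists>k. \<forall>v \<in> pverts G. out_degree (with_proj G) v = k)"

definition is_cone :: "'a pair_pre_digraph \<Rightarrow> bool" where
  "is_cone G \<longleftrightarrow> (\<exists>v \<in> pverts G. out_degree (with_proj G) v = card (pverts G) - 1)"

text \<open>The new vertex is \<^const>\<open>None\<close>; the old vertices are tagged with \<^const>\<open>Some\<close>.\<close>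

definition cone_over :: "'a pair_pre_digraph \<Rightarrow> 'a option pair_pre_digraph" where
  "cone_over G =
     \<lparr> pverts = insert None (Some ` pverts G),
       parcs = map_prod Some Some ` parcs G
               \<union> {None} \<times> Some ` pverts G \<union> Some ` pverts G \<times> {None} \<rparr>"

text \<open>The Petersen graph as the Kneser graph \<open>K(5,2)\<close>.\<close>

definition petersen_graph :: "nat set pair_pre_digraph" where
  "petersen_graph =
     \<lparr> pverts = {A. A \<subseteq> {..<5} \<and> card A = 2},
       parcs = {(A, B). A \<subseteq> {..<5} \<and> card A = 2 \<and> B \<subseteq> {..<5} \<and> card B = 2 \<and> A \<inter> B = {}} \<rparr>"

definition petersen_cone :: "nat set option pair_pre_digraph" where
  "petersen_cone = cone_over petersen_graph"

lemma pair_graph_petersen_graph: "pair_graph petersen_graph"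
proof -
  have fin: "finite {A :: nat set. A \<subseteq> {..<5} \<and> card A = 2}"
    by (rule finite_subset[of _ "Pow {..<5}"]) auto
  have "parcs petersen_graph \<subseteq> pverts petersen_graph \<times> pverts petersen_graph"
    by (auto simp: petersen_graph_def)
  then have "finite (parcs petersen_graph)"
    by (rule finite_subset) (use fin in \<open>simp add: petersen_graph_def\<close>)
  with fin show ?thesis
    by unfold_locales (auto simp: petersen_graph_def symmetric_def sym_def)
qed

lemma pair_graph_cone_over:
  assumes "pair_graph G"
  shows "pair_graph (cone_over G)"
proof -
  interpret pair_graph G by fact
  show ?thesis
    using pair_finite_verts pair_finite_arcs pair_sym_arcs pair_no_loops wellformed'
    by unfold_locales (auto simp: cone_over_def symmetric_def sym_def)
qed

lemma pair_graph_petersen_cone: "pair_graph petersen_cone"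
  unfolding petersen_cone_def by (intro pair_graph_cone_over pair_graph_petersen_graph)

end

theory Submission
  imports Defs
begin

text \<open>
  Perron-Frobenius turns the three-eigenvalue condition into \<open>(A - 1)(A + t) = \<alpha>\<alpha>\<^sup>T\<close> with a positive
  eigenvector \<open>\<alpha>\<close>, so the degrees are \<open>\<alpha>\<^sub>v\<^sup>2 + t\<close> and the numbers of common neighbours are
  \<open>\<alpha>\<^sub>u\<alpha>\<^sub>v + 1 - t\<close> or \<open>\<alpha>\<^sub>u\<alpha>\<^sub>v\<close>. Counting common neighbours with the apex \<open>w\<close> shows that every other
  weight is a root of \<open>z\<^sup>2 - \<alpha>\<^sub>wz + 2(t - 1)\<close>, hence one of \<open>a, b\<close> where \<open>a + b = \<alpha>\<^sub>w\<close>, \<open>ab = 2(t - 1)\<close>.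

  If only one weight occurs, the eigenvector equations force \<open>a\<^sup>2 = t = 2\<close>, and deleting \<open>w\<close> leaves a
  strongly regular graph with parameters \<open>(10, 3, 0, 1)\<close>, that is, the Petersen graph. If both occur,
  counting the edges between the two classes twice gives a quadratic equation for \<open>s\<close>. For \<open>a > b\<close>, an edge
  inside the \<open>b\<close>-class forces \<open>b\<^sup>2 \<ge> t\<close>, which makes its discriminant negative (up to one case excluded by
  integrality); otherwise \<open>s\<close> is determined by \<open>a, b\<close> and the quadratic becomes a Diophantine equation in
  \<open>b\<^sup>2\<close> and \<open>t\<close> without solutions.
\<close>

section \<open>Polynomials in a symmetric operator\<close>

text \<open>A real root of the complexified polynomial gives a linear factor. At a nonreal root z,
  the remainder of \<open>p\<close> modulo (X - Re z)^2 + (Im z)^2 has real coefficients and degree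
  below 2, so vanishing at z forces it to be zero.\<close>

lemma real_poly_factor:
  fixes p :: "real poly"
  assumes "degree p > 0"
  shows "(\<exists>r. [:-r, 1:] dvd p) \<or> (\<exists>a b. b \<noteq> 0 \<and> [:a\<^sup>2 + b\<^sup>2, -2 * a, 1:] dvd p)"
proof -
  interpret hom: map_poly_comm_ring_hom complex_of_real ..
  let ?P = "map_poly complex_of_real p"
  have "\<not> constant (poly ?P)"
    using assms by (simp add: constant_degree)
  then obtain z where z: "poly ?P z = 0"
    using fundamental_theorem_of_algebra by blast
  show ?thesis
  proof (cases "Im z = 0")
    case True
    then have "z = of_real (Re z)"
      by (simp add: complex_eq_iff)
    with z have "poly p (Re z) = 0"
      by (metis of_real_0 of_real_eq_iff of_real_hom.poly_map_poly)
    then show ?thesis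
      by (auto simp: poly_eq_0_iff_dvd)
  next
    case False
    define d where "d = [:(Re z)\<^sup>2 + (Im z)\<^sup>2, -2 * Re z, 1:]"
    define r where "r = p mod d"
    have "degree r < 2"
      using degree_mod_less[of d p] by (auto simp: d_def r_def)
    then have r: "r = [:coeff r 0, coeff r 1:]"
      by (intro poly_eqI) (auto simp: coeff_pCons coeff_eq_0 split: nat.splits)
    have dz: "poly (map_poly complex_of_real d) z = 0"
      by (simp add: d_def complex_eq_iff power2_eq_square algebra_simps)
    have "p = (p div d) * d + r"
      by (simp add: r_def)
    then have "poly (map_poly complex_of_real r) z = 0"
      using z dz by (metis add_0 mult_zero_right hom.hom_add hom.hom_mult poly_add poly_mult)
    moreover have "poly (map_poly complex_of_real [:x, y:]) z = of_real x + z * of_real y" for x y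
      by (simp only: of_real_hom.map_poly_pCons_hom) simp
    ultimately have "of_real (coeff r 0) + z * of_real (coeff r 1) = 0"
      using r by metis
    then have "coeff r 1 = 0" "coeff r 0 = 0"
      using False by (auto simp: complex_eq_iff)
    then have "r = 0"
      using r by simp
    then have "d dvd p"
      by (simp add: r_def mod_eq_0_iff_dvd)
    then show ?thesis
      using False d_def by blast
  qed
qed

text \<open>Models a real symmetric matrix indexed by \<open>V\<close>; vectors are functions on the
  whole type that vanish off \<open>V\<close>. With symmetry, \<open>k_support\<close> makes the
  kernel vanish as soon as either argument leaves \<open>V\<close>.\<close>

locale symmetric_kernel =
  fixes V :: "'a set" and k :: "'a \<Rightarrow> 'a \<Rightarrow> real"
  assumes finite_V: "finite V"
    and k_sym: "k u v = k v u"
    and k_support: "u \<notin> V \<Longrightarrow> k u v = 0"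
begin

definition ap :: "('a \<Rightarrow> real) \<Rightarrow> 'a \<Rightarrow> real" where
  "ap x u = (\<Sum>v\<in>V. k u v * x v)"

definition ip :: "('a \<Rightarrow> real) \<Rightarrow> ('a \<Rightarrow> real) \<Rightarrow> real" where
  "ip x y = (\<Sum>v\<in>V. x v * y v)"

text \<open>The vector p(A)x, where A is the operator \<open>ap\<close>.\<close>

definition ev :: "real poly \<Rightarrow> ('a \<Rightarrow> real) \<Rightarrow> 'a \<Rightarrow> real" where
  "ev p x u = (\<Sum>i\<le>degree p. coeff p i * (ap ^^ i) x u)"

section \<open>Functional calculus for polynomials in the operator\<close>

lemma ev_eq_sum:
  assumes "degree p \<le> n"
  shows "ev p x u = (\<Sum>i\<le>n. coeff p i * (ap ^^ i) x u)"
  unfolding ev_def using assms by (intro sum.mono_neutral_left) (auto simp: coeff_eq_0)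

lemma ap_sum: "ap (\<lambda>u. \<Sum>i\<in>I. c i * f i u) v = (\<Sum>i\<in>I. c i * ap (f i) v)"
  unfolding ap_def sum_distrib_left by (subst sum.swap) (simp add: mult_ac)

lemma ap_add: "ap (\<lambda>u. f u + g u) v = ap f v + ap g v"
  by (simp add: ap_def algebra_simps sum.distrib)

lemma ap_cmult: "ap (\<lambda>u. c * f u) v = c * ap f v"
  by (simp add: ap_def algebra_simps sum_distrib_left)

lemma ap_support: "u \<notin> V \<Longrightarrow> ap x u = 0"
  by (simp add: ap_def k_support)

lemma ap_zero: "ap (\<lambda>u. 0) v = 0"
  by (simp add: ap_def)

lemma ev_0 [simp]: "ev 0 x = (\<lambda>u. 0)"
  by (rule ext) (simp add: ev_def)

lemma ev_pCons: "ev (pCons c p) x = (\<lambda>u. c * x u + ap (ev p x) u)"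
proof
  fix u
  have "ev (pCons c p) x u = (\<Sum>i\<le>Suc (degree p). coeff (pCons c p) i * (ap ^^ i) x u)"
    by (rule ev_eq_sum) (rule degree_pCons_le)
  also have "\<dots> = c * x u + (\<Sum>i\<le>degree p. coeff p i * ap ((ap ^^ i) x) u)"
    by (simp add: sum.atMost_Suc_shift del: sum.atMost_Suc)
  also have "(\<Sum>i\<le>degree p. coeff p i * ap ((ap ^^ i) x) u) = ap (ev p x) u"
    using ap_sum[of "coeff p" "\<lambda>i. (ap ^^ i) x" "{..degree p}" u] by (simp add: ev_def[abs_def])
  finally show "ev (pCons c p) x u = c * x u + ap (ev p x) u" .
qed

lemma ev_const: "ev [:c:] x = (\<lambda>u. c * x u)"
  by (simp add: ev_pCons ap_zero)

lemma ev_linear: "ev [:c, 1:] x = (\<lambda>u. c * x u + ap x u)"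
  by (simp add: ev_pCons ap_zero)

lemma ev_add: "ev (p + q) x u = ev p x u + ev q x u"
proof -
  have "degree (p + q) \<le> max (degree p) (degree q)"
    by (rule degree_add_le_max)
  then show ?thesis
    using ev_eq_sum[of p "max (degree p) (degree q)" x u] ev_eq_sum[of q "max (degree p) (degree q)" x u]
      ev_eq_sum[of "p + q" "max (degree p) (degree q)" x u]
    by (simp add: algebra_simps sum.distrib)
qed

lemma ev_smult: "ev (Polynomial.smult c p) x u = c * ev p x u"
  using ev_eq_sum[OF degree_smult_le, of c p x u] by (simp add: ev_def sum_distrib_left mult_ac)

lemma ev_mult: "ev (p * q) x = ev p (ev q x)"
proof (induction p)
  case 0
  then show ?case by simp
next
  case (pCons c p)
  show ?case
    by (rule ext) (simp add: ev_add ev_smult ev_pCons pCons.IH)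
qed

lemma ev_support: "(\<And>u. u \<notin> V \<Longrightarrow> x u = 0) \<Longrightarrow> u \<notin> V \<Longrightarrow> ev p x u = 0"
  by (cases p) (simp add: ev_pCons ap_support)

lemma ev_commute: "ev p (ev q x) = ev q (ev p x)"
  by (metis ev_mult mult.commute)

lemma ev_zero [simp]: "ev p (\<lambda>u. 0) = (\<lambda>u. 0)"
  by (induction p) (simp_all add: ev_pCons ap_zero)

lemma ap_eq_ev: "ap x = ev [:0, 1:] x"
  by (rule ext) (simp add: ev_pCons ap_def)

section \<open>Self-adjointness and existence of eigenvectors\<close>

lemma ip_commute: "ip x y = ip y x"
  by (simp add: ip_def mult.commute)

lemma ip_add: "ip (\<lambda>u. x u + y u) z = ip x z + ip y z"
  by (simp add: ip_def algebra_simps sum.distrib)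

lemma ip_cmult: "ip (\<lambda>u. c * x u) z = c * ip x z"
  by (simp add: ip_def sum_distrib_left mult_ac)

lemma ip_ap: "ip (ap x) y = ip x (ap y)"
  unfolding ip_def ap_def sum_distrib_left sum_distrib_right
  by (subst sum.swap) (simp add: mult_ac k_sym)

lemma ip_ev: "ip (ev p x) y = ip x (ev p y)"
proof (induction p arbitrary: y)
  case 0
  then show ?case by (simp add: ip_def)
next
  case (pCons c p)
  have "ip (ev (pCons c p) x) y = c * ip x y + ip (ev p x) (ap y)"
    by (simp add: ev_pCons ip_add ip_cmult ip_ap)
  also have "ip (ev p x) (ap y) = ip (ap (ev p y)) x"
    using pCons.IH ev_commute by (metis ip_commute ap_eq_ev)
  also have "c * ip x y + \<dots> = ip x (ev (pCons c p) y)"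
    unfolding ip_commute[of x] ev_pCons ip_add ip_cmult by simp
  finally show ?case .
qed

lemma ip_self_nonneg: "ip x x \<ge> 0"
  by (simp add: ip_def sum_nonneg)

lemma ip_self_eq_0:
  assumes "ip x x = 0" and "\<And>u. u \<notin> V \<Longrightarrow> x u = 0"
  shows "x = (\<lambda>u. 0)"
proof
  fix u
  show "x u = 0"
    using assms finite_V by (cases "u \<in> V") (auto simp: ip_def sum_nonneg_eq_0_iff)
qed

text \<open>The vectors \<open>x, Ax, \<dots>, A\<^sup>nx\<close> are the columns of a square matrix with a zero last row.\<close>
lemma annihilating_poly_exists:
  assumes "\<And>u. u \<notin> V \<Longrightarrow> x u = 0"
  shows "\<exists>p. p \<noteq> 0 \<and> ev p x = (\<lambda>u. 0)"
proof -
  obtain vs where vs: "set vs = V" "distinct vs"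
    using finite_distinct_list[OF finite_V] by blast
  define n where "n = length vs"
  define M where "M = mat (Suc n) (Suc n) (\<lambda>(j, i). if j < n then (ap ^^ i) x (vs ! j) else 0)"
  have M: "M \<in> carrier_mat (Suc n) (Suc n)"
    by (simp add: M_def)
  have "det M = 0"
    unfolding laplace_expansion_row[OF M lessI] by (intro sum.neutral) (simp add: M_def)
  then obtain c where c: "c \<in> carrier_vec (Suc n)" "c \<noteq> 0\<^sub>v (Suc n)" "M *\<^sub>v c = 0\<^sub>v (Suc n)"
    using det_0_iff_vec_prod_zero_field[OF M] by blast
  define p where "p = (\<Sum>i\<le>n. monom (c $ i) i)"
  have coeff_p: "coeff p i = (if i \<le> n then c $ i else 0)" for i
    by (simp add: p_def coeff_sum)
  have deg: "degree p \<le> n"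
    by (rule degree_le) (simp add: coeff_p)
  have "p \<noteq> 0"
  proof
    assume "p = 0"
    then have "c $ i = 0" if "i < Suc n" for i
      using coeff_p[of i] that by simp
    then have "c = 0\<^sub>v (Suc n)"
      using c(1) by (intro eq_vecI) auto
    with c(2) show False by simp
  qed
  moreover have "ev p x u = 0" for u
  proof (cases "u \<in> V")
    case True
    then obtain j where j: "j < n" "u = vs ! j"
      using vs by (metis in_set_conv_nth n_def)
    have "0 = (M *\<^sub>v c) $ j"
      using c j by simp
    also have "\<dots> = (\<Sum>i<Suc n. (ap ^^ i) x u * c $ i)"
      using j c(1) by (simp add: M_def scalar_prod_def lessThan_atLeast0)
    also have "\<dots> = ev p x u"
      unfolding ev_eq_sum[OF deg] lessThan_Suc_atMost by (intro sum.cong) (auto simp: coeff_p)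
    finally show ?thesis by simp
  next
    case False
    then show ?thesis
      using ev_support assms by blast
  qed
  ultimately show ?thesis by blast
qed

text \<open>Stands in for the spectral theorem. Take an annihilator of \<open>x\<close> of least
  degree and split off a real irreducible factor; the cofactor applied to \<open>x\<close> is
  nonzero by minimality. A linear factor makes it an eigenvector, a quadratic one contradicts
  self-adjointness.\<close>

lemma eigenvector_in_cyclic_subspace:
  assumes supp: "\<And>u. u \<notin> V \<Longrightarrow> x u = 0" and "x \<noteq> (\<lambda>u. 0)"
  obtains p r where "ev p x \<noteq> (\<lambda>u. 0)" and "ap (ev p x) = (\<lambda>u. r * ev p x u)"
proof -
  define Ann where "Ann p \<longleftrightarrow> p \<noteq> 0 \<and> ev p x = (\<lambda>u. 0)" for p
  obtain p0 where "Ann p0"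
    using annihilating_poly_exists[of x] supp by (auto simp: Ann_def)
  then obtain p where p: "Ann p" and min: "\<And>q. Ann q \<Longrightarrow> degree p \<le> degree q"
    using ex_has_least_nat[of Ann p0 degree] by blast
  have smaller: "ev q x \<noteq> (\<lambda>u. 0)" if "p = d * q" "degree d > 0" for d q
  proof
    assume "ev q x = (\<lambda>u. 0)"
    moreover have "d \<noteq> 0" "q \<noteq> 0"
      using p that by (auto simp: Ann_def)
    ultimately have "degree p \<le> degree q"
      by (intro min) (simp add: Ann_def)
    then show False
      using that \<open>d \<noteq> 0\<close> \<open>q \<noteq> 0\<close> by (simp add: degree_mult_eq)
  qed
  have "degree p > 0"
  proof (rule ccontr)
    assume "\<not> degree p > 0"
    then obtain c where c: "p = [:c:]"
      using degree_eq_zeroE[of p] by blast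
    then have "\<And>u. c * x u = 0" "c \<noteq> 0"
      using p by (auto simp: Ann_def ev_const fun_eq_iff)
    with assms(2) show False by auto
  qed
  then consider r where "[:-r, 1:] dvd p"
    | a b where "b \<noteq> 0" "[:a\<^sup>2 + b\<^sup>2, -2 * a, 1:] dvd p"
    using real_poly_factor by blast
  then show ?thesis
  proof cases
    case (1 r)
    then obtain q where q: "p = [:-r, 1:] * q" by blast
    have "ev [:-r, 1:] (ev q x) = (\<lambda>u. 0)"
      using p q by (simp add: Ann_def flip: ev_mult)
    then have "ap (ev q x) = (\<lambda>u. r * ev q x u)"
      by (simp add: ev_linear fun_eq_iff)
    then show ?thesis
      using that smaller[OF q] by simp
  next
    case (2 a b)
    then obtain q where q: "p = [:a\<^sup>2 + b\<^sup>2, -2 * a, 1:] * q" by blast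
    define y where "y = ev q x"
    have y: "y \<noteq> (\<lambda>u. 0)"
      unfolding y_def by (rule smaller[OF q]) simp
    define z where "z = ev [:-a, 1:] y"
    have "[:a\<^sup>2 + b\<^sup>2, -2 * a, 1:] = [:-a, 1:] * [:-a, 1:] + [:b\<^sup>2:]"
      by (simp add: power2_eq_square)
    moreover have "ev [:a\<^sup>2 + b\<^sup>2, -2 * a, 1:] y = (\<lambda>u. 0)"
      using p q by (simp add: Ann_def y_def flip: ev_mult)
    ultimately have "ev ([:-a, 1:] * [:-a, 1:]) y u + ev [:b\<^sup>2:] y u = 0" for u
      unfolding ev_add[symmetric] by metis
    then have *: "ev [:-a, 1:] z u + b\<^sup>2 * y u = 0" for u
      unfolding z_def ev_mult by (simp add: ev_const)
    \<comment> \<open>Since (A - a)^2 y = -b^2 y, self-adjointness gives |(A - a)y|^2 = -b^2 |y|^2,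
      which forces y = 0.\<close>
    have "ip z z = ip (ev [:-a, 1:] z) y"
      by (simp add: z_def ip_ev)
    also have "\<dots> = ip (\<lambda>u. (- (b\<^sup>2)) * y u) y"
      using * by (intro arg_cong[where f = "\<lambda>x. ip x y"] ext) (simp add: eq_neg_iff_add_eq_0)
    finally have "ip z z + b\<^sup>2 * ip y y = 0"
      unfolding ip_cmult by simp
    then have "ip y y = 0"
      using ip_self_nonneg[of z] ip_self_nonneg[of y] \<open>b \<noteq> 0\<close>
      by (simp add: add_nonneg_eq_0_iff)
    then have "y = (\<lambda>u. 0)"
      by (rule ip_self_eq_0) (simp add: y_def ev_support supp)
    with y show ?thesis by simp
  qed
qed

lemma ev_eigenvector:
  assumes "ap x = (\<lambda>u. r * x u)"
  shows "ev p x = (\<lambda>u. poly p r * x u)"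
proof (induction p)
  case (pCons c p)
  show ?case
    unfolding ev_pCons pCons.IH ap_cmult using assms by (simp add: fun_eq_iff algebra_simps)
qed simp

text \<open>If p(A)x were nonzero, its cyclic subspace would contain an eigenvector y = p(A)q(A)x.
  Its eigenvalue is a root of \<open>p\<close>, so p(A)y = 0, and moving p(A) across the inner
  product gives |y|^2 = 0.\<close>

lemma poly_annihilates:
  assumes eig: "\<And>x r. x \<noteq> (\<lambda>u. 0) \<Longrightarrow> (\<And>u. u \<notin> V \<Longrightarrow> x u = 0) \<Longrightarrow> ap x = (\<lambda>u. r * x u) \<Longrightarrow> poly p r = 0"
    and supp: "\<And>u. u \<notin> V \<Longrightarrow> x u = 0"
  shows "ev p x = (\<lambda>u. 0)"
proof (rule ccontr)
  assume ne: "ev p x \<noteq> (\<lambda>u. 0)"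
  obtain q r where q: "ev q (ev p x) \<noteq> (\<lambda>u. 0)"
    "ap (ev q (ev p x)) = (\<lambda>u. r * ev q (ev p x) u)"
    by (rule eigenvector_in_cyclic_subspace[OF _ ne]) (simp_all add: ev_support supp)
  define y where "y = ev q (ev p x)"
  have y_supp: "\<And>u. u \<notin> V \<Longrightarrow> y u = 0"
    by (simp add: y_def ev_support supp)
  have "poly p r = 0"
    by (rule eig[of y]) (use q y_supp in \<open>auto simp: y_def\<close>)
  then have "ev p y = (\<lambda>u. 0)"
    using ev_eigenvector[of y r p] q by (simp add: y_def)
  moreover have "ip y y = ip (ev p (ev q x)) y"
    by (simp add: y_def ev_commute)
  ultimately have "ip y y = 0"
    unfolding ip_ev by (simp add: ip_def)
  then have "y = (\<lambda>u. 0)"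
    by (rule ip_self_eq_0) (simp add: y_supp)
  with q show False by (simp add: y_def)
qed

section \<open>Perron-Frobenius at the largest eigenvalue\<close>

lemma ip_cmult_right: "ip z (\<lambda>u. c * x u) = c * ip z x"
  by (simp add: ip_def sum_distrib_left mult_ac)

lemma ip_indicator: "u \<in> V \<Longrightarrow> ip x (\<lambda>v. of_bool (v = u)) = x u"
  unfolding ip_def by (subst sum.remove[OF finite_V]) (auto intro!: sum.neutral)

text \<open>
  With \<open>F\<^sub>1 = (s - A)(A + t)\<close> and \<open>F\<^sub>2 = (A - s)(A - 1)\<close>, both nonnegative multiples of projections,
  \<open>(1 + t)(s - A) = F\<^sub>1 + F\<^sub>2\<close> is positive semidefinite.
\<close>
lemma rayleigh_maximum_is_eigenvector:
  assumes ann: "\<And>x. (\<And>u. u \<notin> V \<Longrightarrow> x u = 0) \<Longrightarrow> ev ([:-s, 1:] * [:-1, 1:] * [:t, 1:]) x = (\<lambda>u. 0)"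
    and "s > 1" "1 > - t"
    and supp: "\<And>u. u \<notin> V \<Longrightarrow> y u = 0"
    and ge: "ip (ap y) y \<ge> s * ip y y"
  shows "ap y = (\<lambda>u. s * y u)"
proof -
  let ?F = "[:s, -1:] * [:t, 1:]" and ?H = "[:-s, 1:] * [:-1, 1:]"
  let ?m = "[:-s, 1:] * [:-1, 1:] * [:t, 1:]"
  \<comment> \<open>\<open>?F\<close> vanishes at s and -t, \<open>?H\<close> at s and 1;
    \<open>c\<close> and \<open>d\<close> are their values at the third root of \<open>?m\<close>.
    So \<open>?F\<close>^2 - c \<open>?F\<close> and \<open>?H\<close>^2 - d \<open>?H\<close>
    vanish at all three roots and are multiples of \<open>?m\<close>.\<close>
  define c d where "c = (s - 1) * (1 + t)" and "d = (s + t) * (1 + t)"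
  have pos: "c > 0" "d > 0"
    using assms by (auto simp: c_def d_def)
  have F: "?F * ?F = Polynomial.smult c ?F + [:1 + t - s, 1:] * ?m"
    by (simp add: c_def algebra_simps)
  have H: "?H * ?H = Polynomial.smult d ?H + [:- (s + 1 + t), 1:] * ?m"
    by (simp add: d_def algebra_simps)
  have FH: "?F + ?H = Polynomial.smult (1 + t) [:s, -1:]"
    by (simp add: algebra_simps)
  have m: "ev (p * ?m) y = (\<lambda>u. 0)" for p
    unfolding ev_mult[of p] using ann supp by simp
  have nF: "ip (ev ?F y) (ev ?F y) = c * ip (ev ?F y) y"
  proof -
    have "ip (ev ?F y) (ev ?F y) = ip (ev (?F * ?F) y) y"
      by (simp only: ip_ev[of ?F] ev_mult[of ?F])
    also have "ev (?F * ?F) y = (\<lambda>u. c * ev ?F y u)"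
      unfolding F by (rule ext) (simp only: ev_add ev_smult m add_0_right)
    finally show ?thesis
      by (simp only: ip_cmult)
  qed
  have nH: "ip (ev ?H y) (ev ?H y) = d * ip (ev ?H y) y"
  proof -
    have "ip (ev ?H y) (ev ?H y) = ip (ev (?H * ?H) y) y"
      by (simp only: ip_ev[of ?H] ev_mult[of ?H])
    also have "ev (?H * ?H) y = (\<lambda>u. d * ev ?H y u)"
      unfolding H by (rule ext) (simp only: ev_add ev_smult m add_0_right)
    finally show ?thesis
      by (simp only: ip_cmult)
  qed
  have sA: "ev [:s, -1:] y = (\<lambda>u. s * y u + (-1) * ap y u)"
    by (rule ext) (simp add: ev_pCons ap_zero ap_cmult[of "-1", simplified])
  have sum: "ev ?F y u + ev ?H y u = (1 + t) * ev [:s, -1:] y u" for u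
    by (simp only: FH ev_smult flip: ev_add)
  have "ip (ev ?F y) y + ip (ev ?H y) y = (1 + t) * ip (ev [:s, -1:] y) y"
    by (simp only: sum ip_cmult flip: ip_add)
  also have "ip (ev [:s, -1:] y) y = s * ip y y - ip (ap y) y"
    by (simp only: sA ip_add ip_cmult)
  also have "(1 + t) * \<dots> \<le> 0"
    using ge assms by (intro mult_nonneg_nonpos) auto
  finally have le: "ip (ev ?F y) y + ip (ev ?H y) y \<le> 0" .
  have "ip (ev ?F y) y \<ge> 0" "ip (ev ?H y) y \<ge> 0"
    using nF nH pos ip_self_nonneg[of "ev ?F y"] ip_self_nonneg[of "ev ?H y"]
    by (simp_all only: zero_le_mult_iff) auto
  with le have "ip (ev ?F y) y = 0" "ip (ev ?H y) y = 0"
    by linarith+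
  then have "ev ?F y = (\<lambda>u. 0)" "ev ?H y = (\<lambda>u. 0)"
    using nF nH ip_self_eq_0[of "ev ?F y"] ip_self_eq_0[of "ev ?H y"] ev_support[of y, OF supp]
    by simp_all
  then have "(1 + t) * ev [:s, -1:] y u = 0" for u
    using sum[of u] by (simp del: mult_pCons_left mult_pCons_right)
  then have "ev [:s, -1:] y u = 0" for u
    using assms(3) by simp
  then show ?thesis
    by (simp add: sA fun_eq_iff)
qed

text \<open>A zero of a nonnegative eigenvector spreads to all neighbours. As \<open>w\<close> is
  adjacent to everything else, it inherits the zero and passes it on to all of
  \<open>V\<close>.\<close>

lemma dominated_nonneg_eigenvector_pos:
  assumes nonneg: "\<And>u v. k u v \<ge> 0" and w: "w \<in> V" "\<And>v. v \<in> V \<Longrightarrow> v \<noteq> w \<Longrightarrow> k w v > 0"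
    and y: "\<And>v. y v \<ge> 0" "\<And>u. u \<notin> V \<Longrightarrow> y u = 0" "y \<noteq> (\<lambda>u. 0)" "ap y = (\<lambda>u. s * y u)"
    and v: "v \<in> V"
  shows "y v > 0"
proof (rule ccontr)
  assume "\<not> y v > 0"
  with y(1)[of v] have v0: "y v = 0" by linarith
  have nbr: "k a b * y b = 0" if "a \<in> V" "b \<in> V" "y a = 0" for a b
  proof -
    have "(\<Sum>b\<in>V. k a b * y b) = 0"
      using fun_cong[OF y(4), of a] that by (simp add: ap_def)
    then show ?thesis
      using that finite_V nonneg y(1) by (subst (asm) sum_nonneg_eq_0_iff) auto
  qed
  have yw: "y w = 0"
    using nbr[OF v w(1) v0] w(2)[OF v] v0 k_sym[of v w] by (cases "v = w") auto
  have "y u = 0" for u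
    using nbr[OF w(1) _ yw, of u] w(2)[of u] yw y(2)[of u]
    by (cases "u \<in> V"; cases "u = w") auto
  with y(3) show False by auto
qed

text \<open>With Q = (X - 1)(X + t), every column of Q(A) lies in the s-eigenspace because (A -
  s)Q(A) = 0. That eigenspace is a line spanned by a positive \<open>y\<close>, so the symmetric
  matrix Q(A) is \<kappa> y y^T, and \<kappa> > 0 since Q(s) > 0.\<close>

lemma rank_one_decomposition:
  assumes nonneg: "\<And>u v. k u v \<ge> 0" and w: "w \<in> V" "\<And>v. v \<in> V \<Longrightarrow> v \<noteq> w \<Longrightarrow> k w v > 0"
    and st: "s > 1" "1 > - t"
    and eig: "\<And>x r. x \<noteq> (\<lambda>u. 0) \<Longrightarrow> (\<And>u. u \<notin> V \<Longrightarrow> x u = 0) \<Longrightarrow> ap x = (\<lambda>u. r * x u)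
      \<Longrightarrow> r \<in> {s, 1, - t}"
    and x0: "x0 \<noteq> (\<lambda>u. 0)" "\<And>u. u \<notin> V \<Longrightarrow> x0 u = 0" "ap x0 = (\<lambda>u. s * x0 u)"
  obtains \<alpha> where "\<And>v. v \<in> V \<Longrightarrow> \<alpha> v > 0" and "ap \<alpha> = (\<lambda>u. s * \<alpha> u)"
    and "\<And>u v. u \<in> V \<Longrightarrow> v \<in> V \<Longrightarrow> ev ([:-1, 1:] * [:t, 1:]) (\<lambda>u. of_bool (u = v)) u = \<alpha> u * \<alpha> v"
proof -
  let ?m = "[:-s, 1:] * [:-1, 1:] * [:t, 1:]"
  define Q where "Q = [:-1, 1:] * [:t, 1:]"
  have ann: "ev ?m x = (\<lambda>u. 0)" if "\<And>u. u \<notin> V \<Longrightarrow> x u = 0" for x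
  proof (rule poly_annihilates)
    fix x r
    assume "x \<noteq> (\<lambda>u. 0)" "\<And>u. u \<notin> V \<Longrightarrow> x u = 0" "ap x = (\<lambda>u. r * x u)"
    then have "r \<in> {s, 1, - t}" by (rule eig)
    then show "poly ?m r = 0" by (auto simp: algebra_simps)
  qed (use that in simp)
  \<comment> \<open>Nonnegative entries give |x| a Rayleigh quotient of at least s, so
    \<open>rayleigh_maximum_is_eigenvector\<close> applies to it.\<close>
  have abs_eig: "ap (\<lambda>u. \<bar>x u\<bar>) = (\<lambda>u. s * \<bar>x u\<bar>)"
    if "\<And>u. u \<notin> V \<Longrightarrow> x u = 0" "ap x = (\<lambda>u. s * x u)" for x
  proof (rule rayleigh_maximum_is_eigenvector[OF ann st])
    have "s * ip (\<lambda>u. \<bar>x u\<bar>) (\<lambda>u. \<bar>x u\<bar>) = ip (ap x) x"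
      unfolding that(2) ip_cmult by (simp add: ip_def)
    also have "\<dots> \<le> ip (ap (\<lambda>u. \<bar>x u\<bar>)) (\<lambda>u. \<bar>x u\<bar>)"
      unfolding ip_def
    proof (rule sum_mono)
      fix v
      have "ap x v * x v \<le> \<bar>ap x v\<bar> * \<bar>x v\<bar>"
        by (metis abs_ge_self abs_mult)
      also have "\<bar>ap x v\<bar> \<le> ap (\<lambda>u. \<bar>x u\<bar>) v"
        unfolding ap_def by (rule order.trans[OF sum_abs]) (simp add: abs_mult nonneg)
      finally show "ap x v * x v \<le> ap (\<lambda>u. \<bar>x u\<bar>) v * \<bar>x v\<bar>"
        by (simp add: mult_right_mono)
    qed
    finally show "s * ip (\<lambda>u. \<bar>x u\<bar>) (\<lambda>u. \<bar>x u\<bar>) \<le> ip (ap (\<lambda>u. \<bar>x u\<bar>)) (\<lambda>u. \<bar>x u\<bar>)" .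
  qed (use that in auto)
  have abs_pos: "\<bar>x v\<bar> > 0"
    if "\<And>u. u \<notin> V \<Longrightarrow> x u = 0" "ap x = (\<lambda>u. s * x u)" "x \<noteq> (\<lambda>u. 0)" "v \<in> V" for x v
  proof (rule dominated_nonneg_eigenvector_pos[OF nonneg w _ _ _ abs_eig[OF that(1,2)] that(4)])
    show "(\<lambda>u. \<bar>x u\<bar>) \<noteq> (\<lambda>u. 0)"
      using that(3) by (auto simp: fun_eq_iff)
  qed (use that in auto)
  define y where "y = (\<lambda>u. \<bar>x0 u\<bar>)"
  have y_eig: "ap y = (\<lambda>u. s * y u)" and y_supp: "\<And>u. u \<notin> V \<Longrightarrow> y u = 0"
    and y_pos: "\<And>v. v \<in> V \<Longrightarrow> y v > 0"
    using abs_eig[OF x0(2,3)] abs_pos[OF x0(2,3,1)] x0(2) by (auto simp: y_def)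
  define z where "z v = ev Q (\<lambda>u. of_bool (u = v))" for v
  define c where "c v = z v w / y w" for v
  have z_supp: "z v u = 0" if "v \<in> V" "u \<notin> V" for u v
    unfolding z_def using that by (intro ev_support) auto
  have z_c: "z v u = c v * y u" if v: "v \<in> V" for u v
  proof -
    have "ev [:-s, 1:] (z v) = ev ?m (\<lambda>u. of_bool (u = v))"
      by (simp only: z_def Q_def mult.assoc flip: ev_mult)
    also have "\<dots> = (\<lambda>u. 0)"
      using v by (intro ann) auto
    finally have z_eig: "ap (z v) = (\<lambda>u. s * z v u)"
      by (simp add: ev_linear fun_eq_iff)
    \<comment> \<open>Subtracting the multiple of \<open>y\<close> that cancels the entry at
      \<open>w\<close> leaves a vector that \<open>abs_pos\<close> forces to be zero: the
      s-eigenspace is one-dimensional.\<close>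
    define x where "x u = z v u + (- c v) * y u" for u
    have "ap x = (\<lambda>u. s * x u)"
      unfolding x_def[abs_def] by (rule ext) (simp only: ap_add ap_cmult z_eig y_eig, simp add: algebra_simps)
    moreover have "\<And>u. u \<notin> V \<Longrightarrow> x u = 0"
      using z_supp[OF v] y_supp by (simp add: x_def)
    moreover have "x w = 0"
      using y_pos[OF w(1)] by (simp add: x_def c_def)
    ultimately have "x = (\<lambda>u. 0)"
      using abs_pos[of x w] w(1) by auto
    then show ?thesis
      by (simp add: x_def fun_eq_iff)
  qed
  have z_sym: "z v u = z u v" if "u \<in> V" "v \<in> V" for u v
  proof -
    have "z v u = ip (z v) (\<lambda>x. of_bool (x = u))"
      using that by (simp add: ip_indicator)
    also have "\<dots> = ip (z u) (\<lambda>x. of_bool (x = v))"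
      unfolding z_def ip_ev[of Q "\<lambda>x. of_bool (x = v)"] by (rule ip_commute)
    also have "\<dots> = z u v"
      using that by (simp add: ip_indicator)
    finally show ?thesis .
  qed
  define \<kappa> where "\<kappa> = c w / y w"
  have c_\<kappa>: "c v = \<kappa> * y v" if "v \<in> V" for v
    using z_sym[OF w(1) that] z_c[OF that] z_c[OF w(1)] y_pos[OF w(1)] by (simp add: \<kappa>_def field_simps)
  have "\<kappa> > 0"
  proof -
    \<comment> \<open>The entry at \<open>w\<close> of Q(A)y, computed directly and through the
      column \<open>z w\<close>, compares \<kappa> with Q(s).\<close>
    have "poly Q s * y w = ip (ev Q y) (\<lambda>x. of_bool (x = w))"
      using w(1) by (simp add: ip_indicator ev_eigenvector[OF y_eig])
    also have "\<dots> = ip y (z w)"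
      by (simp add: ip_ev z_def)
    also have "\<dots> = c w * ip y y"
      using z_c[OF w(1)] ip_cmult_right[of y "c w" y] by presburger
    finally have "poly Q s * y w = \<kappa> * (y w * ip y y)"
      using c_\<kappa>[OF w(1)] by simp
    moreover have "poly Q s * y w > 0"
      unfolding Q_def poly_mult using st y_pos[OF w(1)] by simp
    moreover have "y w * ip y y \<ge> 0"
      using y_pos[OF w(1)] ip_self_nonneg[of y] by simp
    ultimately show ?thesis
      by (metis not_less zero_less_mult_iff)
  qed
  define \<alpha> where "\<alpha> = (\<lambda>u. sqrt \<kappa> * y u)"
  show ?thesis
  proof (rule that[of \<alpha>])
    show "\<alpha> v > 0" if "v \<in> V" for v
      using y_pos[OF that] \<open>\<kappa> > 0\<close> by (simp add: \<alpha>_def)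
    show "ap \<alpha> = (\<lambda>u. s * \<alpha> u)"
      unfolding \<alpha>_def by (rule ext) (simp add: ap_cmult y_eig)
    show "ev ([:-1, 1:] * [:t, 1:]) (\<lambda>u. of_bool (u = v)) u = \<alpha> u * \<alpha> v" if "u \<in> V" "v \<in> V" for u v
    proof -
      have "\<alpha> u * \<alpha> v = (sqrt \<kappa> * sqrt \<kappa>) * y u * y v"
        by (simp only: \<alpha>_def mult_ac)
      also have "\<dots> = z v u"
        using z_c[OF that(2), of u] c_\<kappa>[OF that(2)] \<open>\<kappa> > 0\<close> by simp
      finally show ?thesis
        by (simp only: z_def Q_def)
    qed
  qed
qed

end

section \<open>Weights of a cone with three eigenvalues\<close>

definition nbrs :: "'a pair_pre_digraph \<Rightarrow> 'a \<Rightarrow> 'a set" where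
  "nbrs G v = parcs G `` {v}"

lemma in_nbrs_iff: "u \<in> nbrs G v \<longleftrightarrow> (v, u) \<in> parcs G"
  by (simp add: nbrs_def)

context pair_graph
begin

lemma nbrs_subset: "nbrs G v \<subseteq> pverts G"
  by (auto simp: in_nbrs_iff dest: in_arcsD2)

lemma finite_nbrs [simp]: "finite (nbrs G v)"
  using nbrs_subset pair_finite_verts by (rule finite_subset)

lemma nbrs_sym: "u \<in> nbrs G v \<longleftrightarrow> v \<in> nbrs G u"
  using pair_sym_arcs by (auto simp: in_nbrs_iff symmetric_def sym_def)

lemma not_in_nbrs_self [simp]: "v \<notin> nbrs G v"
  using pair_no_loops[of "(v, v)"] by (auto simp: in_nbrs_iff)

lemma out_degree_eq_card_nbrs: "out_degree (with_proj G) v = card (nbrs G v)"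
proof -
  have "out_arcs (with_proj G) v = Pair v ` nbrs G v"
    by (auto simp: out_arcs_def in_nbrs_iff)
  then show ?thesis
    by (simp add: out_degree_def card_image inj_on_def)
qed

text \<open>Carries \<open>rank_one_decomposition\<close> over to the adjacency matrix. The last
  conclusion is the (u,v) entry of A^2 + (t - 1)A - tI = \<alpha> \<alpha>^T, where A^2 counts
  common neighbours.\<close>

lemma three_eigenvalue_cone_weights:
  assumes vs: "distinct vs" "set vs = pverts G"
    and spec: "spectrum (adjacency_matrix G vs) = {s, 1, - t}" and st: "s > 1" "1 > - t"
    and w: "w \<in> pverts G" "nbrs G w = pverts G - {w}"
  obtains \<alpha> :: "'a \<Rightarrow> real" where "\<And>v. v \<in> pverts G \<Longrightarrow> \<alpha> v > 0"
    and "\<And>v. v \<in> pverts G \<Longrightarrow> (\<Sum>u\<in>nbrs G v. \<alpha> u) = s * \<alpha> v"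
    and "\<And>u v. u \<in> pverts G \<Longrightarrow> v \<in> pverts G \<Longrightarrow>
      real (card (nbrs G u \<inter> nbrs G v)) + (t - 1) * of_bool (v \<in> nbrs G u) - t * of_bool (u = v) = \<alpha> u * \<alpha> v"
proof -
  let ?V = "pverts G"
  define k :: "'a \<Rightarrow> 'a \<Rightarrow> real" where "k u v = of_bool (v \<in> nbrs G u)" for u v
  interpret symmetric_kernel ?V k
    by unfold_locales
      (use nbrs_sym nbrs_subset in \<open>auto simp: k_def pair_finite_verts in_nbrs_iff dest: in_arcsD1\<close>)
  have ap_eq: "ap x v = (\<Sum>u\<in>nbrs G v. x u)" for x v
    unfolding ap_def k_def using nbrs_subset
    by (intro sum.mono_neutral_cong_right) (auto simp: pair_finite_verts)
  let ?n = "length vs" and ?A = "adjacency_matrix G vs"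
  have A: "?A \<in> carrier_mat ?n ?n"
    by (simp add: adjacency_matrix_def)
  have mult: "(?A *\<^sub>v vec ?n (\<lambda>i. x (vs ! i))) $ i = ap x (vs ! i)" if "i < ?n" for x i
  proof -
    have "(?A *\<^sub>v vec ?n (\<lambda>i. x (vs ! i))) $ i = (\<Sum>j<?n. k (vs ! i) (vs ! j) * x (vs ! j))"
      using that by (simp add: adjacency_matrix_def scalar_prod_def lessThan_atLeast0 k_def
          in_nbrs_iff of_bool_def cong: sum.cong_simp)
    also have "\<dots> = ap x (vs ! i)"
      unfolding ap_def using vs
      by (intro sum.reindex_bij_betw[where h = "(!) vs" and g = "\<lambda>v. k (vs ! i) v * x v"] bij_betw_nth) auto
    finally show ?thesis .
  qed
  have eig: "r \<in> {s, 1, - t}"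
    if x: "x \<noteq> (\<lambda>u. 0)" "\<And>u. u \<notin> ?V \<Longrightarrow> x u = 0" "ap x = (\<lambda>u. r * x u)" for x r
  proof -
    let ?x = "vec ?n (\<lambda>i. x (vs ! i))"
    obtain v where "x v \<noteq> 0" "v \<in> ?V"
      using x(1,2) by blast
    then obtain i where i: "i < ?n" "x (vs ! i) \<noteq> 0"
      using vs by (metis in_set_conv_nth)
    have "?x \<noteq> 0\<^sub>v ?n"
      using i by (metis index_vec index_zero_vec(1))
    moreover have "?A *\<^sub>v ?x = r \<cdot>\<^sub>v ?x"
      using mult[of _ x] A by (intro eq_vecI) (simp_all add: x(3))
    ultimately have "eigenvalue ?A r"
      unfolding eigenvalue_def eigenvector_def using A by (intro exI[of _ ?x]) auto
    then show ?thesis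
      using spec by (auto simp: spectrum_def)
  qed
  obtain x0 where x0: "x0 \<noteq> (\<lambda>u. 0)" "\<And>u. u \<notin> ?V \<Longrightarrow> x0 u = 0" "ap x0 = (\<lambda>u. s * x0 u)"
  proof -
    have "eigenvalue ?A s"
      using spec by (auto simp: spectrum_def)
    then obtain y where y: "y \<in> carrier_vec ?n" "y \<noteq> 0\<^sub>v ?n" "?A *\<^sub>v y = s \<cdot>\<^sub>v y"
      using A unfolding eigenvalue_def eigenvector_def by auto
    define ix where "ix = the_inv_into {..<?n} ((!) vs)"
    have ix: "ix (vs ! i) = i" if "i < ?n" for i
      unfolding ix_def using vs that by (intro the_inv_into_f_f inj_on_nth) auto
    define x where "x v = (if v \<in> ?V then y $ ix v else 0)" for v
    have yx: "y = vec ?n (\<lambda>i. x (vs ! i))"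
      using y(1) vs ix by (intro eq_vecI) (auto simp: x_def)
    have "ap x v = s * x v" for v
    proof (cases "v \<in> ?V")
      case True
      then obtain i where "i < ?n" "v = vs ! i"
        using vs by (metis in_set_conv_nth)
      then show ?thesis
        using mult[of i x] y(3) by (simp flip: yx) (simp add: yx)
    qed (simp add: x_def ap_support)
    moreover have "x \<noteq> (\<lambda>u. 0)"
    proof
      assume "x = (\<lambda>u. 0)"
      then have "y = 0\<^sub>v ?n"
        unfolding yx by (intro eq_vecI) auto
      with y(2) show False by simp
    qed
    ultimately show ?thesis
      by (intro that[of x]) (auto simp: x_def)
  qed
  obtain \<alpha> where \<alpha>: "\<And>v. v \<in> ?V \<Longrightarrow> \<alpha> v > 0" "ap \<alpha> = (\<lambda>u. s * \<alpha> u)"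
    "\<And>u v. u \<in> ?V \<Longrightarrow> v \<in> ?V \<Longrightarrow> ev ([:-1, 1:] * [:t, 1:]) (\<lambda>u. of_bool (u = v)) u = \<alpha> u * \<alpha> v"
    by (rule rank_one_decomposition[OF _ w(1) _ st eig x0]) (use w in \<open>auto simp: k_def\<close>)
  show ?thesis
  proof (rule that[of \<alpha>])
    show "(\<Sum>u\<in>nbrs G v. \<alpha> u) = s * \<alpha> v" for v
      using fun_cong[OF \<alpha>(2), of v] by (simp add: ap_eq)
    show "real (card (nbrs G u \<inter> nbrs G v)) + (t - 1) * of_bool (v \<in> nbrs G u) - t * of_bool (u = v) = \<alpha> u * \<alpha> v"
      if "u \<in> ?V" "v \<in> ?V" for u v
    proof -
      let ?d = "\<lambda>u. of_bool (u = v) :: real"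
      have ap_d: "ap ?d = (\<lambda>u. of_bool (u \<in> nbrs G v))"
        by (rule ext) (simp add: ap_eq of_bool_def nbrs_sym[of v])
      have "ap (ap ?d) u = real (card (nbrs G u \<inter> nbrs G v))"
        unfolding ap_d by (simp add: ap_eq of_bool_def sum.If_cases Int_def)
      moreover have "ev ([:-1, 1:] * [:t, 1:]) ?d u = - t * ?d u + ((t - 1) * ap ?d u + ap (ap ?d) u)"
        by (simp add: ev_pCons ap_zero ap_add ap_cmult)
      ultimately show ?thesis
        using \<alpha>(3)[OF that] by (simp add: ap_d nbrs_sym[of v] algebra_simps)
    qed
  qed (rule \<alpha>(1))
qed

end

section \<open>The arithmetic of two weights\<close>

text \<open>Here \<open>N\<close> counts the vertices other than the apex and \<open>k\<close> the
  neighbours of such a vertex other than the apex. Eliminating \<open>s\<close> from the eigenvector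
  equations at the apex and at another vertex leaves b(a^2 - 2)(a + b/2) = 0.\<close>

lemma cone_weight_of_uniform:
  fixes a b s t N k :: real
  assumes "a > 0" "b > 0" "a * b = 2 * (t - 1)"
    and "N = (a + b)\<^sup>2 + t" and "k + 1 = a\<^sup>2 + t"
    and "s * (a + b) = N * a" and "s * a = (a + b) + k * a"
  shows "a\<^sup>2 = 2"
proof -
  have t: "t = 1 + a * b / 2"
    using assms(3) by (simp add: field_simps)
  have "N * a * a = (a + b + k * a) * (a + b)"
    using assms by (metis mult.commute mult.left_commute)
  moreover have "k = a\<^sup>2 + t - 1"
    using assms by simp
  ultimately have "b * (a\<^sup>2 - 2) * (a + b / 2) = 0"
    unfolding assms(4) t by (simp add: algebra_simps power2_eq_square add_divide_distrib) 
  moreover have "a + b / 2 > 0"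
    using assms by simp
  ultimately show ?thesis
    using assms(2) by auto
qed

text \<open>\<open>na\<close>, \<open>nb\<close> are the sizes of the classes of weight
  \<open>a\<close>, \<open>b\<close>; \<open>xa\<close>, \<open>ya\<close> count the neighbours in
  the two classes of a vertex of the first, \<open>xb\<close>, \<open>yb\<close> of a vertex of the
  second. Degree and eigenvector equations make \<open>na\<close>, \<open>nb\<close>,
  \<open>ya\<close>, \<open>xb\<close>, times a - b, linear in \<open>s\<close>, so counting the
  cross edges twice (\<open>dc\<close>) gives a quadratic.\<close>

lemma cone_quadratic:
  fixes a b s t na nb xa ya xb yb :: real
  assumes "a \<noteq> b" "a > 0" "b > 0" "a * b = 2 * (t - 1)"
    and n: "na + nb = (a + b)\<^sup>2 + t" "na * a + nb * b = s * (a + b)"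
    and A: "1 + xa + ya = a\<^sup>2 + t" "(a + b) + xa * a + ya * b = s * a"
    and B: "1 + xb + yb = b\<^sup>2 + t" "(a + b) + xb * a + yb * b = s * b"
    and dc: "na * ya = nb * xb"
  shows "s\<^sup>2 - s * ((a + b)\<^sup>2 - a * b / 2) + (a * b - 1) * ((a + b)\<^sup>2 + 1 + a * b / 2) = 0"
proof -
  define M where "M = (a + b)\<^sup>2 + 1 + a * b / 2"
  have t: "t = 1 + a * b / 2"
    using assms(4) by (simp add: field_simps)
  have ya: "ya * (a - b) = a * (a\<^sup>2 + a * b / 2) - s * a + (a + b)"
  proof -
    have xa: "xa = a\<^sup>2 + a * b / 2 - ya"
      using A(1) t by simp
    show ?thesis
      using A(2) unfolding xa by (simp add: algebra_simps)
  qed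
  have xb: "xb * (a - b) = s * b - (a + b) - b * (b\<^sup>2 + a * b / 2)"
  proof -
    have yb: "yb = b\<^sup>2 + a * b / 2 - xb"
      using B(1) t by simp
    show ?thesis
      using B(2) unfolding yb by (simp add: algebra_simps)
  qed
  have M: "na + nb = M"
    using n t by (simp add: M_def)
  have na: "na * (a - b) = s * (a + b) - b * M"
    using n(2) unfolding M[symmetric] by (simp add: algebra_simps)
  have nb: "nb * (a - b) = a * M - s * (a + b)"
    using n(2) unfolding M[symmetric] by (simp add: algebra_simps)
  have "(na * (a - b)) * (ya * (a - b)) = (nb * (a - b)) * (xb * (a - b))"
    using dc by (simp add: algebra_simps)
  then have "(s * (a + b) - b * M) * (a * (a\<^sup>2 + a * b / 2) - s * a + (a + b))
    = (a * M - s * (a + b)) * (s * b - (a + b) - b * (b\<^sup>2 + a * b / 2))"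
    unfolding na nb ya xb .
  moreover have "(a * M - s * (a + b)) * (s * b - (a + b) - b * (b\<^sup>2 + a * b / 2))
      - (s * (a + b) - b * M) * (a * (a\<^sup>2 + a * b / 2) - s * a + (a + b))
    = (a + b) * (a - b) * (s\<^sup>2 - s * ((a + b)\<^sup>2 - a * b / 2) + (a * b - 1) * M)"
    by (simp add: field_simps power2_eq_square)
  ultimately have "(a + b) * (a - b) * (s\<^sup>2 - s * ((a + b)\<^sup>2 - a * b / 2) + (a * b - 1) * M) = 0"
    by simp
  moreover have "a + b > 0"
    using assms by simp
  ultimately show ?thesis
    using assms(1) by (auto simp: M_def)
qed

text \<open>The case of no edge inside the \<open>b\<close>-class, with m = t - 1: a vertex there
  has b^2 + m neighbours of weight \<open>a\<close>, which determines \<open>s\<close>. Substituting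
  into the quadratic and cancelling m + b^2 leaves a relation in b^2 and \<open>m\<close>
  alone.\<close>

lemma cone_cubic:
  fixes a b s m :: real
  assumes "a > 0" "b > 0" "a * b = 2 * m"
    and s: "(a + b) + (b\<^sup>2 + m) * a = s * b"
    and quad: "s\<^sup>2 - s * ((a + b)\<^sup>2 - a * b / 2) + (a * b - 1) * ((a + b)\<^sup>2 + 1 + a * b / 2) = 0"
  shows "(b\<^sup>2)\<^sup>2 + b\<^sup>2 * (m - 3 * m\<^sup>2) + 2 * m ^ 3 - 2 * m = 0"
proof -
  \<comment> \<open>Multiplying the quadratic by B^2 clears denominators: both sB and B(a + b)^2 are
    polynomials in \<open>B\<close> and \<open>m\<close>.\<close>
  define B S where "B = b\<^sup>2" and "S = s * B"
  have m: "m > 0"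
    using assms by (metis mult_pos_pos zero_less_mult_pos zero_less_numeral)
  have S: "S = B * (2 * m + 1) + 2 * m * (m + 1)"
  proof -
    have "S = ((a + b) + (b\<^sup>2 + m) * a) * b"
      unfolding s by (simp add: S_def B_def power2_eq_square)
    also have "\<dots> = a * b + B + (B + m) * (a * b)"
      by (simp add: B_def algebra_simps power2_eq_square)
    finally show ?thesis
      unfolding assms(3) by (simp add: algebra_simps)
  qed
  define T where "T = (a + b)\<^sup>2"
  have "T * B = (a * b + B)\<^sup>2"
    by (simp add: T_def B_def algebra_simps power2_eq_square)
  then have T: "T * B = (2 * m + B)\<^sup>2"
    unfolding assms(3) .
  have "S\<^sup>2 - S * (T * B - m * B) + (2 * m - 1) * B * (T * B + B + m * B)
      = B\<^sup>2 * (s\<^sup>2 - s * (T - m) + (2 * m - 1) * (T + 1 + m))"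
    by (simp add: S_def algebra_simps power2_eq_square)
  also have "\<dots> = 0"
    using quad unfolding assms(3) by (simp add: T_def)
  finally have "S\<^sup>2 - S * ((2 * m + B)\<^sup>2 - m * B) + (2 * m - 1) * B * ((2 * m + B)\<^sup>2 + B + m * B) = 0"
    unfolding T .
  moreover have "S\<^sup>2 - S * ((2 * m + B)\<^sup>2 - m * B) + (2 * m - 1) * B * ((2 * m + B)\<^sup>2 + B + m * B)
      = - 2 * ((m + B) * (B\<^sup>2 + B * (m - 3 * m\<^sup>2) + 2 * m ^ 3 - 2 * m))"
    unfolding S by (simp add: algebra_simps power2_eq_square power3_eq_cube)
  ultimately have "(m + B) * (B\<^sup>2 + B * (m - 3 * m\<^sup>2) + 2 * m ^ 3 - 2 * m) = 0"
    by simp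
  moreover have "m + B > 0"
    using m by (simp add: B_def add_pos_nonneg)
  ultimately show ?thesis
    by (auto simp: B_def)
qed

text \<open>The smaller root \<open>B\<close> lies strictly between \<open>2m/3\<close> and \<open>(2m + 2)/3\<close>, which forces \<open>3B = 2m + 1\<close>.\<close>
lemma cone_cubic_no_solution:
  fixes m B :: int
  assumes "m \<ge> 1" "B > 0" "B < 2 * m"
  shows "B\<^sup>2 + B * (m - 3 * m\<^sup>2) + 2 * m ^ 3 - 2 * m \<noteq> 0"
proof
  assume eq: "B\<^sup>2 + B * (m - 3 * m\<^sup>2) + 2 * m ^ 3 - 2 * m = 0"
  show False
  proof (cases "m = 1")
    case True
    with assms have "B = 1" by simp
    with True eq show False by simp
  next
    case False
    with assms have m: "m \<ge> 2" by simp
    have low: "3 * B > 2 * m"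
    proof (rule ccontr)
      assume *: "\<not> ?thesis"
      \<comment> \<open>Writing 3B = 2m - d turns nine times the left side into nonnegative terms
        plus 10m^2 - 18m, which is positive from m = 2 on.\<close>
      define d where "d = 2 * m - 3 * B"
      have "d \<ge> 0" using * by (simp add: d_def)
      have "9 * (B\<^sup>2 + B * (m - 3 * m\<^sup>2) + 2 * m ^ 3 - 2 * m)
        = d\<^sup>2 + d * (9 * m\<^sup>2 - 7 * m) + 10 * m\<^sup>2 - 18 * m"
        unfolding d_def by (simp add: algebra_simps power2_eq_square power3_eq_cube)
      moreover have "d * (9 * m\<^sup>2 - 7 * m) \<ge> 0"
        using \<open>d \<ge> 0\<close> m by (intro mult_nonneg_nonneg) (auto simp: power2_eq_square mult_right_mono)
      moreover have "10 * m\<^sup>2 - 18 * m > 0"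
        using mult_right_mono[of 2 m m] m by (simp add: power2_eq_square)
      ultimately show False
        using eq by (smt (verit) zero_le_power2)
    qed
    have up: "3 * B < 2 * m + 2"
    proof (rule ccontr)
      assume *: "\<not> ?thesis"
      \<comment> \<open>Now 3B = 2m + 2 + d, and B < 2m caps \<open>d\<close> at 4m, which keeps the
        factor multiplying -d nonnegative; the value is then negative.\<close>
      define d where "d = 3 * B - (2 * m + 2)"
      have "d \<ge> 0" "d \<le> 4 * m" using * assms by (auto simp: d_def)
      have "9 * (B\<^sup>2 + B * (m - 3 * m\<^sup>2) + 2 * m ^ 3 - 2 * m)
        = - d * (9 * m\<^sup>2 - 7 * m - 4 - d) - (8 * m\<^sup>2 + 4 * m - 4)"
        unfolding d_def by (simp add: algebra_simps power2_eq_square power3_eq_cube)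
      moreover have "9 * m\<^sup>2 - 7 * m - 4 - d \<ge> 0"
        using mult_right_mono[of 2 m m] m \<open>d \<le> 4 * m\<close> unfolding power2_eq_square by linarith
      then have "d * (9 * m\<^sup>2 - 7 * m - 4 - d) \<ge> 0"
        using \<open>d \<ge> 0\<close> by simp
      moreover have "8 * m\<^sup>2 + 4 * m - 4 > 0"
        using mult_right_mono[of 2 m m] m unfolding power2_eq_square by linarith
      ultimately show False
        using eq by simp
    qed
    have B: "3 * B = 2 * m + 1"
      using low up by simp
    have "9 * (B\<^sup>2 + B * (m - 3 * m\<^sup>2) + 2 * m ^ 3 - 2 * m)
        = (3 * B)\<^sup>2 + 3 * (3 * B) * (m - 3 * m\<^sup>2) + 18 * m ^ 3 - 18 * m"
      by (simp add: algebra_simps power2_eq_square)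
    also have "\<dots> = m\<^sup>2 - 11 * m + 1"
      unfolding B by (simp add: algebra_simps power2_eq_square power3_eq_cube)
    finally have "9 * (B\<^sup>2 + B * (m - 3 * m\<^sup>2) + 2 * m ^ 3 - 2 * m) = m\<^sup>2 - 11 * m + 1" .
    then have "m * (11 - m) = 1"
      using eq by (simp add: algebra_simps power2_eq_square)
    then have "m dvd 1"
      by (metis dvd_triv_left)
    with m show False by simp
  qed
qed

text \<open>For c = (a + b)^2 and q = ab this is the quadratic of \<open>cone_quadratic\<close>.
  Completing the square in \<open>s\<close> reduces positivity to 4(q - 1)(p + 1 + q) > p^2 with p =
  c - q/2.\<close>

lemma cone_discriminant_negative:
  fixes c q s :: real
  assumes "q \<ge> 6" "4 * q \<le> c" "2 * c \<le> 9 * q"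
  shows "s\<^sup>2 - s * (c - q / 2) + (q - 1) * (c + 1 + q / 2) > 0"
proof -
  define p where "p = c - q / 2"
  have p: "7 * q / 2 \<le> p" "p \<le> 4 * q"
    using assms by (auto simp: p_def)
  \<comment> \<open>By convexity p^2 lies below its chord on [7q/2, 4q]; what remains is linear in
    \<open>p\<close>.\<close>
  have 1: "2 * p\<^sup>2 \<le> 15 * q * p - 28 * q\<^sup>2"
    using mult_nonneg_nonneg[of "2 * p - 7 * q" "4 * q - p"] p by (simp add: algebra_simps power2_eq_square)
  have 2: "p * (7 * q + 8) \<le> 4 * q * (7 * q + 8)"
    using p assms by (intro mult_right_mono) auto
  have 3: "6 * q \<le> q * q"
    using assms by (intro mult_right_mono) auto
  have "0 < (15 * q * p - 28 * q\<^sup>2 - 2 * p\<^sup>2)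
      + (4 * q * (7 * q + 8) - p * (7 * q + 8)) + 8 * (q * q - 6 * q) + (16 * q - 8)"
    by (intro add_nonneg_pos add_nonneg_nonneg mult_nonneg_nonneg) (use 1 2 3 assms(1) in linarith)+
  also have "\<dots> = 2 * (4 * (q - 1) * (p + 1 + q) - p\<^sup>2)"
    by (simp add: algebra_simps power2_eq_square)
  finally have "4 * (q - 1) * (p + 1 + q) - p\<^sup>2 > 0"
    by simp
  moreover have "s\<^sup>2 - s * p + (q - 1) * (p + 1 + q) = (s - p / 2)\<^sup>2 + (4 * (q - 1) * (p + 1 + q) - p\<^sup>2) / 4"
    by (simp add: power2_eq_square field_simps)
  ultimately have "s\<^sup>2 - s * p + (q - 1) * (p + 1 + q) > 0"
    by (simp add: add_nonneg_pos)
  then show ?thesis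
    by (simp add: p_def algebra_simps)
qed

section \<open>The two possible weights\<close>

text \<open>Keeps what the counting arguments use of the spectrum: a positive eigenvector and the
  entries of the rank-one identity, which fix the degrees and common-neighbour counts.\<close>

locale weighted_cone = pair_graph G for G :: "'a pair_pre_digraph" +
  fixes w :: 'a and \<alpha> :: "'a \<Rightarrow> real" and s t :: real
  assumes w_in: "w \<in> pverts G" and nbrs_w: "nbrs G w = pverts G - {w}"
    and \<alpha>_pos: "v \<in> pverts G \<Longrightarrow> \<alpha> v > 0"
    and \<alpha>_eigen: "v \<in> pverts G \<Longrightarrow> (\<Sum>u\<in>nbrs G v. \<alpha> u) = s * \<alpha> v"
    and common_nbrs: "u \<in> pverts G \<Longrightarrow> v \<in> pverts G \<Longrightarrow>
      real (card (nbrs G u \<inter> nbrs G v)) + (t - 1) * of_bool (v \<in> nbrs G u) - t * of_bool (u = v) = \<alpha> u * \<alpha> v"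
begin

abbreviation H :: "'a set" where "H \<equiv> pverts G - {w}"

lemma finite_H: "finite H"
  using pair_finite_verts by simp

lemma w_nbr: "v \<in> H \<Longrightarrow> w \<in> nbrs G v"
  using nbrs_w nbrs_sym by blast

lemma degree: "v \<in> pverts G \<Longrightarrow> real (card (nbrs G v)) = (\<alpha> v)\<^sup>2 + t"
  using common_nbrs[of v v] by (simp add: power2_eq_square)

lemma common_adj:
  "u \<in> pverts G \<Longrightarrow> v \<in> nbrs G u \<Longrightarrow> real (card (nbrs G u \<inter> nbrs G v)) = \<alpha> u * \<alpha> v + 1 - t"
  using common_nbrs[of u v] nbrs_subset[of u] by (cases "u = v") auto

lemma common_nonadj:
  "u \<in> pverts G \<Longrightarrow> v \<in> pverts G \<Longrightarrow> u \<noteq> v \<Longrightarrow> v \<notin> nbrs G u \<Longrightarrow>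
    real (card (nbrs G u \<inter> nbrs G v)) = \<alpha> u * \<alpha> v"
  using common_nbrs[of u v] by simp

lemma nbrs_H: "v \<in> H \<Longrightarrow> nbrs G v = insert w (nbrs G v \<inter> H)"
  using w_nbr[of v] nbrs_subset[of v] by auto

lemma card_nbrs_H: "v \<in> H \<Longrightarrow> real (card (nbrs G v \<inter> H)) + 1 = (\<alpha> v)\<^sup>2 + t"
  using degree[of v] nbrs_H[of v] by (metis Diff_iff Int_iff card.insert finite_Int finite_nbrs insertI1 of_nat_Suc add.commute)

lemma weight_quadratic:
  assumes "v \<in> H"
  shows "(\<alpha> v)\<^sup>2 - \<alpha> w * \<alpha> v + 2 * (t - 1) = 0"
proof -
  have "nbrs G w \<inter> nbrs G v = nbrs G v \<inter> H"
    using nbrs_w by auto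
  then show ?thesis
    using common_adj[OF w_in, of v] card_nbrs_H[OF assms] assms nbrs_w by auto
qed

lemma card_H: "real (card H) = (\<alpha> w)\<^sup>2 + t"
  using degree[OF w_in] nbrs_w by simp

lemma nonregular_weights:
  assumes "\<not> regular_graph G"
  obtains a b where "a > 0" "b > 0" "\<alpha> w = a + b" "a * b = 2 * (t - 1)" "t > 1"
    "\<And>v. v \<in> H \<Longrightarrow> \<alpha> v = a \<or> \<alpha> v = b" "\<exists>v\<in>H. \<alpha> v = a"
proof -
  \<comment> \<open>If t \<le> 1, every weight is at least that of the apex, hence so is every
    degree; the graph is then complete and thus regular.\<close>
  have t: "t > 1"
  proof (rule ccontr)
    assume "\<not> t > 1"
    have "card (nbrs G v) = card (pverts G) - 1" if v: "v \<in> pverts G" for v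
    proof (cases "v = w")
      case True
      then show ?thesis using nbrs_w w_in by simp
    next
      case False
      with v have vH: "v \<in> H" by simp
      have "\<alpha> v * (\<alpha> v - \<alpha> w) = 2 * (1 - t)"
        using weight_quadratic[OF vH] by (simp add: algebra_simps power2_eq_square)
      then have "\<alpha> v * (\<alpha> v - \<alpha> w) \<ge> 0"
        using \<open>\<not> t > 1\<close> by simp
      then have "\<alpha> w \<le> \<alpha> v"
        using \<alpha>_pos[OF v] by (simp add: zero_le_mult_iff)
      then have "(\<alpha> w)\<^sup>2 \<le> (\<alpha> v)\<^sup>2"
        using \<alpha>_pos[OF w_in] by (intro power_mono) auto
      then have "real (card (nbrs G v)) \<ge> real (card (nbrs G w))"
        using degree[OF v] degree[OF w_in] by simp
      moreover have "nbrs G v \<subseteq> pverts G - {v}"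
        using nbrs_subset by auto
      then have "card (nbrs G v) \<le> card (pverts G - {v})"
        using pair_finite_verts by (intro card_mono) auto
      ultimately show ?thesis
        using nbrs_w v w_in by simp
    qed
    then have "regular_graph G"
      unfolding regular_graph_def out_degree_eq_card_nbrs by blast
    with assms show False by simp
  qed
  have "H \<noteq> {}"
  proof
    assume "H = {}"
    then have "pverts G = {w}"
      using w_in by auto
    then have "regular_graph G"
      unfolding regular_graph_def by auto
    with assms show False by simp
  qed
  then obtain v0 where v0: "v0 \<in> H" by auto
  \<comment> \<open>\<open>b\<close> is the other root of the weight quadratic; it may equal
    \<open>a\<close>, and no vertex need carry it.\<close>
  define a b where "a = \<alpha> v0" and "b = \<alpha> w - a"
  have a: "a > 0"
    using v0 \<alpha>_pos by (simp add: a_def)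
  have ab: "a * b = 2 * (t - 1)"
    using weight_quadratic[OF v0] by (simp add: a_def b_def algebra_simps power2_eq_square)
  then have b: "b > 0"
    using a t by (metis diff_gt_0_iff_gt mult_pos_pos zero_less_mult_pos zero_less_numeral)
  show ?thesis
  proof (rule that[of a b])
    show "\<alpha> v = a \<or> \<alpha> v = b" if "v \<in> H" for v
    proof -
      have "(\<alpha> v - a) * (\<alpha> v - b) = 0"
        using weight_quadratic[OF that] ab by (simp add: b_def algebra_simps power2_eq_square)
      then show ?thesis by auto
    qed
  qed (use a b ab t v0 in \<open>auto simp: a_def b_def\<close>)
qed

text \<open>Once a^2 = 2, a vertex of \<open>H\<close> has t + 1 neighbours in \<open>H\<close>, so
  \<open>t\<close> is an integer. Two adjacent vertices of \<open>H\<close> share the apex, so a^2 +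
  1 - t \<ge> 1, which with t > 1 leaves t = 2.\<close>

lemma uniform_weight:
  assumes "a > 0" "b > 0" "\<alpha> w = a + b" "a * b = 2 * (t - 1)" "t > 1"
    and u: "\<And>v. v \<in> H \<Longrightarrow> \<alpha> v = a" and v0: "v0 \<in> H"
  shows "t = 2" "a\<^sup>2 = 2" "a = b"
proof -
  define k where "k = real (card (nbrs G v0 \<inter> H))"
  have "(\<Sum>u\<in>nbrs G v0. \<alpha> u) = (a + b) + k * a"
    using nbrs_H[OF v0] u assms(3) by (subst nbrs_H[OF v0], subst sum.insert) (auto simp: k_def)
  then have 1: "s * a = (a + b) + k * a"
    using \<alpha>_eigen[of v0] v0 u by simp
  have "(\<Sum>u\<in>nbrs G w. \<alpha> u) = real (card H) * a"
    unfolding nbrs_w using u by simp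
  then have 2: "s * (a + b) = real (card H) * a"
    using \<alpha>_eigen[OF w_in] assms(3) by simp
  have k1: "k + 1 = a\<^sup>2 + t"
    using card_nbrs_H[OF v0] u[OF v0] by (simp add: k_def)
  show a2: "a\<^sup>2 = 2"
    by (rule cone_weight_of_uniform[OF assms(1,2,4) _ k1 2 1]) (use card_H assms(3) in simp)
  have kt: "k = t + 1"
    using k1 a2 by simp
  then have "nbrs G v0 \<inter> H \<noteq> {}"
    using assms(5) by (auto simp: k_def)
  then obtain x where x: "x \<in> nbrs G v0" "x \<in> H" by auto
  have "w \<in> nbrs G v0 \<inter> nbrs G x"
    using w_nbr v0 x by auto
  then have "card (nbrs G v0 \<inter> nbrs G x) \<ge> 1"
    by (metis One_nat_def Suc_leI card_gt_0_iff empty_iff finite_Int finite_nbrs)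
  then have "a * a + 1 - t \<ge> 1"
    using common_adj[of v0 x] x v0 u by simp
  then have "t \<le> 2"
    using a2 by (simp add: power2_eq_square)
  moreover have "t = of_int (int (card (nbrs G v0 \<inter> H)) - 1)"
    using kt by (simp add: k_def)
  ultimately show t2: "t = 2"
    using assms(5) by simp
  have "a * b = a * a"
    using assms(4) t2 a2 by (simp add: power2_eq_square)
  then show "a = b"
    using assms(1) by simp
qed

text \<open>For a vertex of \<open>H\<close>, degree and eigenvector equation are two independent
  linear equations for its neighbour counts in the two classes, so these depend only on its class
  and \<open>cone_quadratic\<close> applies. The split is on whether the lighter class contains an
  edge.\<close>

lemma no_two_weights:
  assumes "a > b" "b > 0" "\<alpha> w = a + b" "a * b = 2 * (t - 1)" "t > 1"
    and two: "\<And>v. v \<in> H \<Longrightarrow> \<alpha> v = a \<or> \<alpha> v = b"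
    and ex: "va \<in> H" "\<alpha> va = a" "vb \<in> H" "\<alpha> vb = b"
  shows False
proof -
  define A B where "A = {v\<in>H. \<alpha> v = a}" and "B = {v\<in>H. \<alpha> v = b}"
  have H: "H = A \<union> B" "A \<inter> B = {}" "finite A" "finite B"
    using two assms(1) finite_H by (auto simp: A_def B_def)
  have weights: "\<And>v. v \<in> A \<Longrightarrow> \<alpha> v = a" "\<And>v. v \<in> B \<Longrightarrow> \<alpha> v = b"
    by (auto simp: A_def B_def)
  have a: "a > 0" using assms by simp
  have t: "t = 1 + a * b / 2"
    using assms(4) by (simp add: field_simps)
  define x y where "x v = real (card (nbrs G v \<inter> A))" and "y v = real (card (nbrs G v \<inter> B))" for v
  have split: "nbrs G v = insert w ((nbrs G v \<inter> A) \<union> (nbrs G v \<inter> B))" if "v \<in> H" for v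
    using nbrs_H[OF that] H by auto
  have wAB: "w \<notin> A" "w \<notin> B"
    using H by auto
  have deg: "1 + x v + y v = (\<alpha> v)\<^sup>2 + t" if "v \<in> H" for v
  proof -
    have "card (nbrs G v) = Suc (card (nbrs G v \<inter> A) + card (nbrs G v \<inter> B))"
      by (subst split[OF that], subst card.insert) (use wAB H in \<open>auto intro!: card_Un_disjoint\<close>)
    then show ?thesis
      using degree[of v] that by (simp add: x_def y_def)
  qed
  have eigen: "(a + b) + x v * a + y v * b = s * \<alpha> v" if "v \<in> H" for v
  proof -
    have "(\<Sum>u\<in>nbrs G v. \<alpha> u) = \<alpha> w + ((\<Sum>u\<in>nbrs G v \<inter> A. \<alpha> u) + (\<Sum>u\<in>nbrs G v \<inter> B. \<alpha> u))"
      by (subst split[OF that], subst sum.insert) (use wAB H in \<open>auto intro!: sum.union_disjoint\<close>)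
    also have "(\<Sum>u\<in>nbrs G v \<inter> A. \<alpha> u) = x v * a"
      by (simp add: weights x_def)
    also have "(\<Sum>u\<in>nbrs G v \<inter> B. \<alpha> u) = y v * b"
      by (simp add: weights y_def)
    finally show ?thesis
      using \<alpha>_eigen[of v] that assms(3) by simp
  qed
  have n: "real (card A) + real (card B) = (a + b)\<^sup>2 + t"
    using card_H card_Un_disjoint[OF H(3,4,2)] H(1) assms(3) by simp
  have ne: "real (card A) * a + real (card B) * b = s * (a + b)"
  proof -
    have "(\<Sum>u\<in>nbrs G w. \<alpha> u) = (\<Sum>u\<in>A. \<alpha> u) + (\<Sum>u\<in>B. \<alpha> u)"
      unfolding nbrs_w H(1) using H by (intro sum.union_disjoint) auto
    then show ?thesis
      using \<alpha>_eigen[OF w_in] assms(3) by (simp add: weights)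
  qed
  have y_const: "y v = y va" if "v \<in> A" for v
  proof -
    have v: "v \<in> H" "\<alpha> v = a" using that by (auto simp: A_def)
    have "y v * (a - b) = a * (a\<^sup>2 + t - 1) - s * a + (a + b)" if "v \<in> H" "\<alpha> v = a" for v
    proof -
      have *: "x v = a\<^sup>2 + t - 1 - y v"
        using deg[OF that(1)] that(2) by simp
      then show ?thesis
        using eigen[OF that(1)] unfolding * that(2) by (simp add: algebra_simps)
    qed
    from this[OF v] this[OF ex(1,2)] have "y v * (a - b) = y va * (a - b)"
      by (simp only:)
    then show ?thesis
      using assms(1) by simp
  qed
  have x_const: "x v = x vb" if "v \<in> B" for v
  proof -
    have v: "v \<in> H" "\<alpha> v = b" using that by (auto simp: B_def)
    have "x v * (a - b) = s * b - (a + b) - b * (b\<^sup>2 + t - 1)" if "v \<in> H" "\<alpha> v = b" for v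
    proof -
      have *: "y v = b\<^sup>2 + t - 1 - x v"
        using deg[OF that(1)] that(2) by simp
      then show ?thesis
        using eigen[OF that(1)] unfolding * that(2) by (simp add: algebra_simps)
    qed
    from this[OF v] this[OF ex(3,4)] have "x v * (a - b) = x vb * (a - b)"
      by (simp only:)
    then show ?thesis
      using assms(1) by simp
  qed
  have dc: "real (card A) * y va = real (card B) * x vb"
  proof -
    have "real (card A) * y va = (\<Sum>u\<in>A. y u)"
      using y_const by simp
    also have "\<dots> = (\<Sum>u\<in>A. \<Sum>v\<in>B. of_bool (v \<in> nbrs G u))"
      unfolding y_def using H by (simp add: of_bool_def sum.If_cases Int_def conj_commute)
    also have "\<dots> = (\<Sum>v\<in>B. \<Sum>u\<in>A. of_bool (u \<in> nbrs G v))"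
      by (subst sum.swap) (use nbrs_sym in \<open>auto intro!: sum.cong\<close>)
    also have "\<dots> = (\<Sum>v\<in>B. x v)"
      unfolding x_def using H by (simp add: of_bool_def sum.If_cases Int_def conj_commute)
    also have "\<dots> = real (card B) * x vb"
      using x_const by simp
    finally show ?thesis .
  qed
  have quad: "s\<^sup>2 - s * ((a + b)\<^sup>2 - a * b / 2) + (a * b - 1) * ((a + b)\<^sup>2 + 1 + a * b / 2) = 0"
    by (rule cone_quadratic[OF _ a assms(2,4) n ne _ _ _ _ dc])
      (use deg[OF ex(1)] eigen[OF ex(1)] deg[OF ex(3)] eigen[OF ex(3)] ex assms(1) in auto)
  have b2: "b\<^sup>2 < a * b"
    using assms(1,2) by (simp add: power2_eq_square)
  have w_common: "card (nbrs G u \<inter> nbrs G v) \<ge> 1" if "u \<in> H" "v \<in> H" for u v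
  proof -
    have "w \<in> nbrs G u \<inter> nbrs G v"
      using w_nbr that by auto
    then show ?thesis
      by (metis One_nat_def Suc_leI card_gt_0_iff empty_iff finite_Int finite_nbrs)
  qed
  \<comment> \<open>Adjacent \<open>u\<close>, \<open>v\<close> of different weight have ab + 1 - t
    = t - 1 common neighbours, the apex among them, so t - 1 is a positive integer.\<close>
  have t_int: "\<exists>m::int. t = of_int m + 1 \<and> m \<ge> 1" if "u \<in> A" "v \<in> B" "v \<in> nbrs G u" for u v
  proof -
    have uv: "u \<in> H" "v \<in> H" using that H by auto
    have "real (card (nbrs G u \<inter> nbrs G v)) = t - 1"
      using common_adj[of u v] uv that weights assms(4) by simp
    then have "t = of_int (int (card (nbrs G u \<inter> nbrs G v))) + 1" by simp
    then show ?thesis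
      using w_common[OF uv] by (metis of_nat_1 of_nat_le_iff)
  qed
  have b2_int: "b\<^sup>2 = of_int (int (card (nbrs G vb)) - m - 1)" if "t = of_int m + 1" for m
    using degree[of vb] ex that by simp
  show False
  proof (cases "\<exists>u\<in>B. \<exists>v\<in>B. v \<in> nbrs G u")
    \<comment> \<open>Here the neighbours of \<open>vb\<close> are the apex and vertices of
      \<open>A\<close>, so \<open>cone_cubic\<close> applies, with b^2 an integer below 2m.\<close>
    case False
    then have "nbrs G vb \<inter> B = {}"
      using ex by (auto simp: B_def)
    then have y0: "y vb = 0" by (simp add: y_def)
    have "x vb > 0"
      using deg[OF ex(3)] y0 ex(4) assms(2,5) by (smt (verit) zero_less_power)
    then have "nbrs G vb \<inter> A \<noteq> {}"
      by (auto simp: x_def)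
    then obtain u where "u \<in> nbrs G vb" "u \<in> A" by auto
    then obtain m :: int where m: "t = of_int m + 1" "m \<ge> 1"
      using t_int[of u vb] nbrs_sym ex by (auto simp: B_def)
    define C where "C = int (card (nbrs G vb)) - m - 1"
    have C: "b\<^sup>2 = of_int C"
      using b2_int[OF m(1)] by (simp add: C_def)
    have ab: "a * b = 2 * of_int m"
      using assms(4) m(1) by simp
    have "x vb = b\<^sup>2 + of_int m"
      using deg[OF ex(3)] y0 ex(4) m(1) by simp
    then have "(a + b) + (b\<^sup>2 + of_int m) * a = s * b"
      using eigen[OF ex(3)] y0 ex(4) by simp
    from cone_cubic[OF a assms(2) ab this quad]
    have "real_of_int (C\<^sup>2 + C * (m - 3 * m\<^sup>2) + 2 * m ^ 3 - 2 * m) = 0"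
      unfolding C by simp
    then have "C\<^sup>2 + C * (m - 3 * m\<^sup>2) + 2 * m ^ 3 - 2 * m = 0"
      by (simp only: of_int_eq_0_iff)
    moreover have "C > 0"
      using C assms(2) by (metis of_int_0_less_iff zero_less_power)
    moreover have "C < 2 * m"
      using b2 unfolding ab C by linarith
    ultimately show False
      using cone_cubic_no_solution[OF m(2)] by blast
  next
    case True
    then obtain u v where uv: "u \<in> B" "v \<in> B" "v \<in> nbrs G u" by blast
    have "real (card (nbrs G u \<inter> nbrs G v)) = b\<^sup>2 + 1 - t"
      using common_adj[of u v] uv weights H by (auto simp: power2_eq_square)
    then have bt: "b\<^sup>2 \<ge> t"
      using w_common[of u v] uv H by simp
    \<comment> \<open>Without cross edges \<open>va\<close> and \<open>vb\<close> share only the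
      apex, so ab \<le> 1, against ab > b^2 \<ge> t > 1. A cross edge is what makes \<open>t\<close>
      integral.\<close>
    have cross: "\<exists>u\<in>A. \<exists>v\<in>B. v \<in> nbrs G u"
    proof (rule ccontr)
      assume no: "\<not> ?thesis"
      have A: "va \<in> A" "vb \<in> B" using ex by (auto simp: A_def B_def)
      then have "vb \<notin> nbrs G va" using no by blast
      then have q: "real (card (nbrs G va \<inter> nbrs G vb)) = a * b"
        using common_nonadj[of va vb] ex assms(1) by auto
      have "nbrs G va \<inter> nbrs G vb \<subseteq> {w}"
        using no A nbrs_sym split[OF ex(1)] split[OF ex(3)] by blast
      then have "card (nbrs G va \<inter> nbrs G vb) \<le> card {w}"
        by (intro card_mono) auto
      then have "a * b \<le> 1" using q by simp
      then show False using bt b2 assms(5) by simp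
    qed
    then obtain m :: int where m: "t = of_int m + 1" "m \<ge> 1"
      using t_int by blast
    have ab: "a * b = 2 * of_int m"
      using assms(4) m(1) by simp
    define C where "C = int (card (nbrs G vb)) - m - 1"
    define D where "D = int (card (nbrs G va)) - m - 1"
    have C: "b\<^sup>2 = of_int C"
      using b2_int[OF m(1)] by (simp add: C_def)
    have D: "a\<^sup>2 = of_int D"
      using degree[of va] ex m(1) by (simp add: D_def)
    have "C < 2 * m" "C \<ge> m + 1"
      using bt b2 unfolding ab C m(1) by linarith+
    have "real_of_int (C * D) = (a * b)\<^sup>2"
      by (simp add: C[symmetric] D[symmetric] power_mult_distrib)
    then have "real_of_int (C * D) = of_int (4 * m\<^sup>2)"
      unfolding ab by (simp add: power2_eq_square)
    then have CD: "C * D = 4 * m\<^sup>2"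
      by (simp only: of_int_eq_iff)
    have "m \<ge> 2"
      using \<open>C < 2 * m\<close> \<open>C \<ge> m + 1\<close> by simp
    \<comment> \<open>\<open>C\<close> lies strictly between m and 2m and divides 4m^2; for m = 2 it
      would be 3, which does not divide 16. This secures the bound q \<ge> 6 of the discriminant
      estimate.\<close>
    have "m \<noteq> 2"
    proof
      assume "m = 2"
      then have "C = 3" using \<open>C < 2 * m\<close> \<open>C \<ge> m + 1\<close> by simp
      with CD \<open>m = 2\<close> show False by simp presburger
    qed
    then have m3: "m \<ge> 3" using \<open>m \<ge> 2\<close> by simp
    define q where "q = a * b"
    have q6: "q \<ge> 6" using m3 ab by (simp add: q_def)
    have lo: "4 * q \<le> (a + b)\<^sup>2"
      using zero_le_power2[of "a - b"] by (simp add: q_def power2_eq_square algebra_simps)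
    have hi: "2 * (a + b)\<^sup>2 \<le> 9 * q"
    proof -
      \<comment> \<open>Uses b^2 \<ge> t > m = ab/2.\<close>
      have "b * a \<le> b * (2 * b)"
        using bt m(1) ab by (simp add: power2_eq_square mult_ac)
      then have "a \<le> 2 * b"
        using assms(2) by simp
      then have "(2 * b - a) * (2 * a - b) \<ge> 0"
        using assms(1,2) by (intro mult_nonneg_nonneg) auto
      then show ?thesis
        by (simp add: q_def power2_eq_square algebra_simps)
    qed
    show False
      using cone_discriminant_negative[OF q6 lo hi, of s] quad by (simp add: q_def)
  qed
qed

end

section \<open>Uniqueness of the Petersen graph\<close>

text \<open>The pairs are listed in the order in which \<open>petersen_labelling\<close> assigns
  them, so the image of its labelling is literally this set.\<close>

lemma card_2_subsets_5:
  "{A :: nat set. A \<subseteq> {..<5} \<and> card A = 2}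
    = {{0,1}, {2,3}, {2,4}, {3,4}, {0,4}, {1,4}, {1,3}, {0,3}, {1,2}, {0,2}}" (is "?K = ?L")
proof
  show "?K \<subseteq> ?L"
  proof
    fix A :: "nat set"
    assume "A \<in> ?K"
    then obtain p q where A: "A = {p, q}" "p \<noteq> q" "p < 5" "q < 5"
      by (auto simp: card_2_iff)
    then have "p \<in> {0, 1, 2, 3, 4}" "q \<in> {0, 1, 2, 3, 4}" by auto
    with A(2) show "A \<in> ?L"
      unfolding A(1) by (elim insertE emptyE) (simp_all add: doubleton_eq_iff)
  qed
qed auto

text \<open>Rebuilds the graph around a vertex \<open>x\<close>: its three neighbours, then two
  further neighbours of each. Since adjacent vertices have no common neighbour and nonadjacent ones
  exactly one, all edges among the outer six are forced.\<close>

lemma petersen_labelling: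
  fixes P :: "'a set" and N :: "'a \<Rightarrow> 'a set"
  assumes P: "finite P" "card P = 10" and N_P: "\<And>v. N v \<subseteq> P"
    and sym: "\<And>u v. u \<in> N v \<Longrightarrow> v \<in> N u" and irr: "\<And>v. v \<notin> N v"
    and cubic: "\<And>v. v \<in> P \<Longrightarrow> card (N v) = 3"
    and tri: "\<And>u v. u \<in> N v \<Longrightarrow> N u \<inter> N v = {}"
    and com: "\<And>u v. u \<in> P \<Longrightarrow> v \<in> P \<Longrightarrow> u \<noteq> v \<Longrightarrow> u \<notin> N v \<Longrightarrow> card (N u \<inter> N v) = 1"
  obtains f :: "'a \<Rightarrow> nat set" where "bij_betw f P {A. A \<subseteq> {..<5} \<and> card A = 2}"
    and "\<And>u v. u \<in> P \<Longrightarrow> v \<in> P \<Longrightarrow> u \<in> N v \<longleftrightarrow> f u \<inter> f v = {}"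
proof -
  have ex_com: "\<exists>c. c \<in> N u \<and> c \<in> N v" if "u \<in> P" "v \<in> P" "u \<noteq> v" "u \<notin> N v" for u v
    using com[OF that] by (auto simp: card_1_singleton_iff)
  have uniq: "c = d" if "c \<in> N u" "c \<in> N v" "d \<in> N u" "d \<in> N v" "u \<noteq> v" for u v c d
  proof -
    have "u \<notin> N v"
      using tri[of u v] that by auto
    moreover have "u \<in> P" "v \<in> P"
      using that sym N_P by blast+
    ultimately have "card (N u \<inter> N v) = 1"
      using that com by auto
    then obtain e where "N u \<inter> N v = {e}"
      by (auto simp: card_1_singleton_iff)
    then have "c \<in> {e}" "d \<in> {e}"
      using that by blast+
    then show ?thesis by simp
  qed
  have N_eq: "N v = {p, q, r}" if "v \<in> P" "p \<in> N v" "q \<in> N v" "r \<in> N v" "p \<noteq> q" "p \<noteq> r" "q \<noteq> r" for v p q r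
  proof -
    have "{p, q, r} = N v"
      by (rule card_subset_eq) (use that cubic[of v] finite_subset[OF N_P P(1)] in auto)
    then show ?thesis by simp
  qed
  obtain x where x: "x \<in> P"
    using P by fastforce
  obtain y1 y2 y3 where Nx: "N x = {y1, y2, y3}" "y1 \<noteq> y2" "y1 \<noteq> y3" "y2 \<noteq> y3"
    using cubic[OF x] by (auto simp: card_3_iff)
  have yP: "y1 \<in> P" "y2 \<in> P" "y3 \<in> P"
    using N_P[of x] Nx by auto
  have xy: "x \<in> N y1" "x \<in> N y2" "x \<in> N y3"
    using sym Nx by auto
  have xny: "x \<noteq> y1" "x \<noteq> y2" "x \<noteq> y3"
    using irr[of x] Nx by auto
  \<comment> \<open>A vertex at distance two from \<open>x\<close> hangs on only one neighbour of
    \<open>x\<close>, since two neighbours of \<open>x\<close> already share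
    \<open>x\<close>.\<close>
  have layer: "z \<noteq> y1 \<and> z \<noteq> y2 \<and> z \<noteq> y3 \<and> z \<in> P \<and> (\<forall>y'\<in>N x. y' \<noteq> y \<longrightarrow> z \<notin> N y')"
    if "y \<in> N x" "z \<in> N y" "z \<noteq> x" for y z
  proof -
    have "z \<notin> N x"
      using tri[OF that(1)] that(2) by auto
    moreover have "z \<notin> N y'" if "y' \<in> N x" "y' \<noteq> y" for y'
      using uniq[of z y y' x] that \<open>y \<in> N x\<close> \<open>z \<in> N y\<close> \<open>z \<noteq> x\<close> sym by blast
    ultimately show ?thesis
      using that N_P Nx by auto
  qed
  have "card (N y1 - {x}) = 2"
    using cubic[OF yP(1)] xy(1) by simp
  then obtain z11 z12 where z1: "N y1 - {x} = {z11, z12}" "z11 \<noteq> z12"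
    by (auto simp: card_2_iff)
  then have z1': "z11 \<in> N y1" "z11 \<noteq> x" "z12 \<in> N y1" "z12 \<noteq> x" "N y1 = {x, z11, z12}"
    using xy(1) by auto
  have z11: "z11 \<noteq> y1" "z11 \<noteq> y2" "z11 \<noteq> y3" "z11 \<in> P" "z11 \<notin> N y2" "z11 \<notin> N y3"
    using layer[of y1 z11] z1' Nx by auto
  have z12: "z12 \<noteq> y1" "z12 \<noteq> y2" "z12 \<noteq> y3" "z12 \<in> P" "z12 \<notin> N y2" "z12 \<notin> N y3"
    using layer[of y1 z12] z1' Nx by auto
  have x_z: "x \<notin> N z11" "x \<notin> N z12"
    using sym[of x] Nx z11 z12 by auto
  \<comment> \<open>The first index names the neighbour among \<open>y1\<close>, \<open>y2\<close>,
    \<open>y3\<close>; for the four vertices chosen here the second tells which of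
    \<open>z11\<close>, \<open>z12\<close> is adjacent.\<close>
  obtain z21 where z21: "z21 \<in> N z11" "z21 \<in> N y2"
    using ex_com[of z11 y2] z11 yP by auto
  obtain z31 where z31: "z31 \<in> N z11" "z31 \<in> N y3"
    using ex_com[of z11 y3] z11 yP by auto
  obtain z22 where z22: "z22 \<in> N z12" "z22 \<in> N y2"
    using ex_com[of z12 y2] z12 yP by auto
  obtain z32 where z32: "z32 \<in> N z12" "z32 \<in> N y3"
    using ex_com[of z12 y3] z12 yP by auto
  have nx: "z21 \<noteq> x" "z31 \<noteq> x" "z22 \<noteq> x" "z32 \<noteq> x"
    using z21 z31 z22 z32 x_z by auto
  have l21: "z21 \<noteq> y1" "z21 \<noteq> y2" "z21 \<noteq> y3" "z21 \<in> P" "z21 \<notin> N y1" "z21 \<notin> N y3"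
    using layer[of y2 z21] z21 nx Nx by auto
  have l22: "z22 \<noteq> y1" "z22 \<noteq> y2" "z22 \<noteq> y3" "z22 \<in> P" "z22 \<notin> N y1" "z22 \<notin> N y3"
    using layer[of y2 z22] z22 nx Nx by auto
  have l31: "z31 \<noteq> y1" "z31 \<noteq> y2" "z31 \<noteq> y3" "z31 \<in> P" "z31 \<notin> N y1" "z31 \<notin> N y2"
    using layer[of y3 z31] z31 nx Nx by auto
  have l32: "z32 \<noteq> y1" "z32 \<noteq> y2" "z32 \<noteq> y3" "z32 \<in> P" "z32 \<notin> N y1" "z32 \<notin> N y2"
    using layer[of y3 z32] z32 nx Nx by auto
  have z2_ne: "z21 \<noteq> z22"
    using uniq[of z21 z11 z12 y1] z21 z22 z1 z1' l21 sym by blast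
  have z3_ne: "z31 \<noteq> z32"
    using uniq[of z31 z11 z12 y1] z31 z32 z1 z1' l31 sym by blast
  have z23: "z21 \<noteq> z31" "z21 \<noteq> z32" "z22 \<noteq> z31" "z22 \<noteq> z32"
    using z21 z22 l31 l32 by auto
  have Ny2: "N y2 = {x, z21, z22}" and Ny3: "N y3 = {x, z31, z32}"
    by (rule N_eq; use yP xy z21 z22 z31 z32 nx z2_ne z3_ne in simp)+
  \<comment> \<open>The common neighbour of \<open>z21\<close> and \<open>y3\<close> is
    \<open>x\<close>, \<open>z31\<close> or \<open>z32\<close>; \<open>x\<close> is not adjacent to
    \<open>z21\<close>, and \<open>z31\<close> would close a triangle with \<open>z11\<close>. The
    argument for \<open>z22\<close> is the same with \<open>z12\<close>.\<close>
  have "z21 \<notin> N z31" "z22 \<notin> N z32"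
    using tri[of z31 z11] tri[of z32 z12] z31 z32 z21 z22 by auto
  moreover obtain c where "c \<in> N z21" "c \<in> N y3"
    using ex_com[of z21 y3] l21 yP by auto
  moreover obtain d where "d \<in> N z22" "d \<in> N y3"
    using ex_com[of z22 y3] l22 yP by auto
  moreover have "x \<notin> N z21" "x \<notin> N z22"
    using sym[of x] Nx l21 l22 by auto
  ultimately have cross: "z32 \<in> N z21" "z31 \<in> N z22"
    using Ny3 sym by auto
  let ?L = "[x, y1, y2, y3, z11, z12, z21, z22, z31, z32]"
  have z1_ne: "z11 \<noteq> z21" "z11 \<noteq> z22" "z11 \<noteq> z31" "z11 \<noteq> z32"
    "z12 \<noteq> z21" "z12 \<noteq> z22" "z12 \<noteq> z31" "z12 \<noteq> z32"
    using z1'(1,3) l21 l22 l31 l32 by auto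
  have dist: "distinct ?L"
    using Nx(2-) xny z1(2) z1'(2,4) z11(1-3) z12(1-3) nx l21(1-3) l22(1-3) l31(1-3) l32(1-3) z2_ne z3_ne z23 z1_ne
    by (simp add: eq_commute)
  have rev_adj: "y1 \<in> N z11" "y1 \<in> N z12" "y2 \<in> N z21" "y2 \<in> N z22" "y3 \<in> N z31" "y3 \<in> N z32"
    "z11 \<in> N z21" "z11 \<in> N z31" "z12 \<in> N z22" "z12 \<in> N z32" "z21 \<in> N z32" "z22 \<in> N z31"
    by (rule sym, fact)+
  have Nz: "N z11 = {y1, z21, z31}" "N z12 = {y1, z22, z32}" "N z21 = {y2, z11, z32}"
    "N z22 = {y2, z12, z31}" "N z31 = {y3, z11, z22}" "N z32 = {y3, z12, z21}"
    by (rule N_eq; (fact | use dist in simp))+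
  have "set ?L = P"
    using card_subset_eq[OF P(1), of "set ?L"] distinct_card[OF dist] P(2) x yP z11 z12 l21 l22 l31 l32
    by auto
  then have P_eq: "P = {x, y1, y2, y3, z11, z12, z21, z22, z31, z32}" by simp
  \<comment> \<open>\<open>x\<close> gets {0,1} and its neighbours the pairs disjoint from it; every
    outer vertex joins 0 or 1 to the element of {2,3,4} missing from the label of its neighbour in
    \<open>N x\<close>.\<close>
  define f :: "'a \<Rightarrow> nat set" where "f = (\<lambda>_. {})(x := {0,1}, y1 := {2,3}, y2 := {2,4}, y3 := {3,4},
    z11 := {0,4}, z12 := {1,4}, z21 := {1,3}, z22 := {0,3}, z31 := {1,2}, z32 := {0,2})"
  have f: "f x = {0,1}" "f y1 = {2,3}" "f y2 = {2,4}" "f y3 = {3,4}" "f z11 = {0,4}" "f z12 = {1,4}"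
    "f z21 = {1,3}" "f z22 = {0,3}" "f z31 = {1,2}" "f z32 = {0,2}"
    using dist by (simp_all add: f_def)
  have img: "f ` P = {A. A \<subseteq> {..<5} \<and> card A = 2}"
    unfolding P_eq card_2_subsets_5 by (simp add: f)
  moreover have "inj_on f P"
    by (rule eq_card_imp_inj_on[OF P(1)]) (simp add: img n_subsets choose_two P(2))
  ultimately have bij: "bij_betw f P {A. A \<subseteq> {..<5} \<and> card A = 2}"
    by (simp add: bij_betw_def)
  \<comment> \<open>Comparing labels instead of vertices reduces adjacency to a finite check on
    explicit sets.\<close>
  have images: "\<forall>v\<in>P. \<forall>B\<in>f ` P. B \<in> f ` N v \<longleftrightarrow> B \<inter> f v = {}"
    unfolding img card_2_subsets_5 unfolding P_eq
    by (simp add: f Nx(1) z1'(5) Ny2 Ny3 Nz doubleton_eq_iff)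
  have "u \<in> N v \<longleftrightarrow> f u \<inter> f v = {}" if "u \<in> P" "v \<in> P" for u v
  proof -
    have "u \<in> N v \<longleftrightarrow> f u \<in> f ` N v"
      using bij that(1) N_P[of v] by (auto simp: bij_betw_def dest: inj_onD)
    then show ?thesis
      using images that by blast
  qed
  with bij show ?thesis
    by (rule that)
qed

section \<open>From the weights to the Petersen cone\<close>

lemma (in weighted_cone) apex_deletion_petersen:
  assumes "\<not> regular_graph G"
  obtains f :: "'a \<Rightarrow> nat set" where "bij_betw f H {A. A \<subseteq> {..<5} \<and> card A = 2}"
    and "\<And>u v. u \<in> H \<Longrightarrow> v \<in> H \<Longrightarrow> (v, u) \<in> parcs G \<longleftrightarrow> f u \<inter> f v = {}"
proof -
  obtain a b where ab: "a > 0" "b > 0" "\<alpha> w = a + b" "a * b = 2 * (t - 1)" "t > 1"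
    "\<And>v. v \<in> H \<Longrightarrow> \<alpha> v = a \<or> \<alpha> v = b" and "\<exists>v\<in>H. \<alpha> v = a"
    using nonregular_weights[OF assms] by blast
  then obtain va where va: "va \<in> H" "\<alpha> va = a" by blast
  \<comment> \<open>\<open>no_two_weights\<close> expects the larger weight first, so the roles of
    \<open>a\<close> and \<open>b\<close> are swapped when \<open>b\<close> is larger.\<close>
  have all_a: "\<alpha> v = a" if v: "v \<in> H" for v
  proof (rule ccontr)
    assume ne: "\<alpha> v \<noteq> a"
    then have vb: "\<alpha> v = b" using ab(6) v by blast
    show False
    proof (cases "a > b")
      case True
      then show False
        by (rule no_two_weights[where va = va and vb = v]) (use ab va vb v in auto)
    next
      case False
      then have "b > a" using ne vb by simp
      then show False
        by (rule no_two_weights[where va = v and vb = va]) (use ab va vb v in \<open>auto simp: mult.commute\<close>)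
    qed
  qed
  have t: "t = 2" "a\<^sup>2 = 2" "a = b"
    using uniform_weight[OF ab(1-5) all_a va(1)] by auto
  have aa: "a * a = 2"
    using t(2) by (simp add: power2_eq_square)
  have card10: "card H = 10"
  proof -
    have "(a + b)\<^sup>2 = 8"
      using t(3) aa by (simp add: power2_eq_square algebra_simps)
    then have "real (card H) = real 10"
      using card_H ab(3) t(1) by simp
    then show ?thesis
      by (simp only: of_nat_eq_iff)
  qed
  \<comment> \<open>Set to be empty off \<open>H\<close> because \<open>petersen_labelling\<close>
    constrains \<open>N\<close> at every point of the type.\<close>
  define N where "N v = (if v \<in> H then nbrs G v \<inter> H else {})" for v
  have apex: "card (nbrs G u \<inter> nbrs G v) = Suc (card (N u \<inter> N v))" if "u \<in> H" "v \<in> H" for u v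
  proof -
    have "nbrs G u \<inter> nbrs G v = insert w (N u \<inter> N v)"
      using nbrs_H[OF that(1)] nbrs_H[OF that(2)] that by (auto simp: N_def)
    moreover have "w \<notin> N u"
      by (simp add: N_def)
    ultimately show ?thesis
      using finite_H by (simp add: N_def)
  qed
  \<comment> \<open>Deleting the apex lowers every count by one: degree 4 - 1 = 3, and 1 - 1 = 0 or
    2 - 1 = 1 common neighbours for adjacent or nonadjacent vertices.\<close>
  obtain f :: "'a \<Rightarrow> nat set" where f: "bij_betw f H {A. A \<subseteq> {..<5} \<and> card A = 2}"
    "\<And>u v. u \<in> H \<Longrightarrow> v \<in> H \<Longrightarrow> u \<in> N v \<longleftrightarrow> f u \<inter> f v = {}"
  proof (rule petersen_labelling[of H N])
    show "card (N v) = 3" if "v \<in> H" for v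
    proof -
      have "real (card (N v)) = real 3"
        using card_nbrs_H[OF that] all_a[OF that] t aa that by (simp add: N_def)
      then show ?thesis
        by (simp only: of_nat_eq_iff)
    qed
    show "N u \<inter> N v = {}" if "u \<in> N v" for u v
    proof -
      have uv: "u \<in> H" "v \<in> H" "u \<in> nbrs G v"
        using that by (auto simp: N_def split: if_splits)
      then have "real (card (nbrs G v \<inter> nbrs G u)) = 1"
        using common_adj[of v u] all_a t aa by simp
      then have "card (N v \<inter> N u) = 0"
        using apex[OF uv(2,1)] by simp
      then show ?thesis
        using finite_H by (auto simp: N_def split: if_splits)
    qed
    show "card (N u \<inter> N v) = 1" if "u \<in> H" "v \<in> H" "u \<noteq> v" "u \<notin> N v" for u v
    proof -
      have "real (card (nbrs G v \<inter> nbrs G u)) = 2"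
        using common_nonadj[of v u] all_a t aa that by (auto simp: N_def)
      then show ?thesis
        using apex[OF that(2,1)] by (simp add: Int_commute)
    qed
  qed (use card10 finite_H nbrs_sym in \<open>auto simp: N_def split: if_splits\<close>)
  show ?thesis
  proof (rule that[OF f(1)])
    show "(v, u) \<in> parcs G \<longleftrightarrow> f u \<inter> f v = {}" if "u \<in> H" "v \<in> H" for u v
      using f(2)[OF that] that by (simp add: N_def in_nbrs_iff)
  qed
qed

text \<open>Extends an isomorphism from \<open>G\<close> minus \<open>w\<close> onto
  \<open>K\<close> by sending \<open>w\<close> to \<open>None\<close>. Since
  \<open>digraph_iso\<close> asks for equality with the image of \<open>G\<close>, the image vertex
  and arc sets are computed outright.\<close>

lemma (in pair_graph) digraph_iso_cone_over:
  assumes w: "w \<in> pverts G" "nbrs G w = pverts G - {w}"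
    and f: "bij_betw f (pverts G - {w}) (pverts K)"
      "\<And>u v. u \<in> pverts G - {w} \<Longrightarrow> v \<in> pverts G - {w} \<Longrightarrow> (u, v) \<in> parcs G \<longleftrightarrow> (f u, f v) \<in> parcs K"
    and K: "parcs K \<subseteq> pverts K \<times> pverts K"
  shows "digraph_iso (with_proj G) (with_proj (cone_over K))"
proof -
  define h where "h v = (if v = w then None else Some (f v))" for v
  define hom where "hom = \<lparr>iso_verts = h, iso_arcs = map_prod h h, iso_head = snd, iso_tail = fst\<rparr>"
  have inj_h: "inj_on h (pverts G)"
    using f(1) by (auto simp: bij_betw_def inj_on_def h_def)
  have arcs_G: "parcs G \<subseteq> pverts G \<times> pverts G"
    using wellformed' by auto
  have "inj_on (map_prod h h) (parcs G)"
    by (rule inj_on_subset[OF map_prod_inj_on[OF inj_h inj_h] arcs_G])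
  then have "digraph_isomorphism hom"
    using inj_h wf_digraph_axioms by (auto simp: digraph_isomorphism_def hom_def)
  moreover have "with_proj (cone_over K) = app_iso hom (with_proj G)"
  proof -
    have fP: "f ` (pverts G - {w}) = pverts K"
      using f(1) by (simp add: bij_betw_def)
    have "h ` pverts G = insert None (Some ` pverts K)"
    proof -
      have "h ` pverts G = insert (h w) (h ` (pverts G - {w}))"
        using w(1) by blast
      also have "h ` (pverts G - {w}) = Some ` f ` (pverts G - {w})"
        unfolding image_image by (intro image_cong) (auto simp: h_def)
      finally show ?thesis
        by (simp add: fP h_def)
    qed
    moreover have "map_prod h h ` parcs G = parcs (cone_over K)"
    proof (intro equalityI subsetI)
      fix e assume "e \<in> map_prod h h ` parcs G"
      then obtain u v where uv: "(u, v) \<in> parcs G" "e = (h u, h v)" by auto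
      then have "u \<in> pverts G" "v \<in> pverts G" "u \<noteq> v"
        using wellformed' pair_no_loops[of "(u, v)"] by auto
      then show "e \<in> parcs (cone_over K)"
        using uv f(2)[of u v] fP by (auto simp: cone_over_def h_def)
    next
      fix e assume "e \<in> parcs (cone_over K)"
      then consider x y where "(x, y) \<in> parcs K" "e = (Some x, Some y)"
        | x where "x \<in> pverts K" "e = (None, Some x)" | x where "x \<in> pverts K" "e = (Some x, None)"
        by (auto simp: cone_over_def)
      then show "e \<in> map_prod h h ` parcs G"
      proof cases
        case 1
        then have "x \<in> f ` (pverts G - {w})" "y \<in> f ` (pverts G - {w})"
          unfolding fP using K by auto
        then obtain u v where "u \<in> pverts G - {w}" "v \<in> pverts G - {w}" "x = f u" "y = f v"
          by blast
        then show ?thesis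
          using 1 f(2)[of u v] by (intro image_eqI[of _ _ "(u, v)"]) (auto simp: h_def)
      next
        case 2
        then obtain u where "u \<in> pverts G - {w}" "x = f u"
          using fP by (metis imageE)
        then show ?thesis
          using 2 w(2) by (intro image_eqI[of _ _ "(w, u)"]) (auto simp: h_def in_nbrs_iff[symmetric])
      next
        case 3
        then obtain u where "u \<in> pverts G - {w}" "x = f u"
          using fP by (metis imageE)
        then show ?thesis
          using 3 w(2) nbrs_sym
          by (intro image_eqI[of _ _ "(u, w)"]) (auto simp: h_def in_nbrs_iff[symmetric])
      qed
    qed
    ultimately show ?thesis
      by (simp add: app_iso_def hom_def with_proj_def cone_over_def)
  qed
  ultimately show ?thesis
    unfolding digraph_iso_def by blast
qed

theorem theorem3p3:
  fixes G :: "'a pair_pre_digraph" and vs :: "'a list" and s t :: real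
  assumes "pair_graph G"
    and "connected (with_proj G)"
    and "\<not> regular_graph G"
    and "distinct vs" and "set vs = pverts G"
    and "spectrum (adjacency_matrix G vs) = {s, 1, - t}"
    and "s > 1" and "1 > - t"
    and "is_cone G"
  shows "digraph_iso (with_proj G) (with_proj petersen_cone)"
proof -
  interpret pair_graph G by fact
  obtain w where w: "w \<in> pverts G" "card (nbrs G w) = card (pverts G) - 1"
    using assms(9) by (auto simp: is_cone_def out_degree_eq_card_nbrs)
  have nw: "nbrs G w = pverts G - {w}"
    by (rule card_subset_eq) (use w nbrs_subset pair_finite_verts in auto)
  obtain \<alpha> where "\<And>v. v \<in> pverts G \<Longrightarrow> \<alpha> v > 0"
    "\<And>v. v \<in> pverts G \<Longrightarrow> (\<Sum>u\<in>nbrs G v. \<alpha> u) = s * \<alpha> v"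
    "\<And>u v. u \<in> pverts G \<Longrightarrow> v \<in> pverts G \<Longrightarrow>
      real (card (nbrs G u \<inter> nbrs G v)) + (t - 1) * of_bool (v \<in> nbrs G u) - t * of_bool (u = v) = \<alpha> u * \<alpha> v"
    using three_eigenvalue_cone_weights[OF assms(4-8) w(1) nw] by blast
  then interpret weighted_cone G w \<alpha> s t
    using w(1) nw by unfold_locales auto
  obtain f :: "'a \<Rightarrow> nat set" where f: "bij_betw f H {A. A \<subseteq> {..<5} \<and> card A = 2}"
    "\<And>u v. u \<in> H \<Longrightarrow> v \<in> H \<Longrightarrow> (v, u) \<in> parcs G \<longleftrightarrow> f u \<inter> f v = {}"
    using apex_deletion_petersen[OF assms(3)] by blast
  show ?thesis
    unfolding petersen_cone_def
  proof (rule digraph_iso_cone_over[OF w(1) nw, of f])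
    show "bij_betw f H (pverts petersen_graph)"
      using f(1) by (simp add: petersen_graph_def)
    show "(u, v) \<in> parcs G \<longleftrightarrow> (f u, f v) \<in> parcs petersen_graph" if "u \<in> H" "v \<in> H" for u v
      using f(2)[OF that(2,1)] bij_betw_apply[OF f(1) that(1)] bij_betw_apply[OF f(1) that(2)]
      by (auto simp: petersen_graph_def)
    show "parcs petersen_graph \<subseteq> pverts petersen_graph \<times> pverts petersen_graph"
      by (auto simp: petersen_graph_def)
  qed
qed

end
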